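(* Let $G$ be a finite simple graph with independence number three, with independence polynomial $I_G(z)=1+a_1z+a_2z^2+a_3z^3$. If $a_2^2<3a_1a_3$, then the independence attractor $\mathcal{A}(G)$ is totally disconnected.
   Context: An independent set in a simple graph $G$ is a set of pairwise non-adjacent vertices; the independence number is the largest size of an independent set. The independence polynomial is $I_G(z)=\sum_{i=0}^{d}a_iz^i$ with $a_0=1$, where $a_i$ is the number of independent sets with exactly $i$ elements and $d$ is the independence number. The lexicographic product of $G$ with itself has vertex set $V(G)\times V(G)$, with $(a,x)$ adjacent to $(b,y)$ iff $a$ is adjacent to $b$ in $G$, or $a=b$ and $x$ is adjacent to $y$ in $G$; $G^m$ denotes the $m$-fold lexicographic product of $G$ with itself. For a polynomial $f$, $\mathrm{Roots}(f)=\{z\in\mathbb{C}: f(z)=0\}$. The independence attractor is $\mathcal{A}(G)=\lim_{m\to\infty}\mathrm{Roots}(I_{G^m})$, the limit taken in the Hausdorff metric on nonempty compact subsets of $\mathbb{C}$ (this limit exists). A set is totally disconnected if each of its connected components is a single point. *)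

theory Defs
  imports
    "HOL-Analysis.Analysis"
    "HOL-Computational_Algebra.Polynomial"
    "Graph_Theory.Pair_Digraph"
begin

text \<open>
  A finite simple graph is a \<^locale>\<open>pair_graph\<close>: a finite vertex set together with a symmetric
  irreflexive adjacency relation on it.
\<close>

definition independent_set :: "'a pair_pre_digraph \<Rightarrow> 'a set \<Rightarrow> bool" where
  "independent_set G S \<longleftrightarrow> S \<subseteq> pverts G \<and> pairwise (\<lambda>u v. (u, v) \<notin> parcs G) S"

definition independence_number :: "'a pair_pre_digraph \<Rightarrow> nat" where
  "independence_number G = Max (card ` {S. independent_set G S})"

definition num_independent_sets :: "'a pair_pre_digraph \<Rightarrow> nat \<Rightarrow> nat" where
  "num_independent_sets G i = card {S. independent_set G S \<and> card S = i}"

definition independence_poly :: "'a pair_pre_digraph \<Rightarrow> complex poly" where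
  "independence_poly G =
     (\<Sum>i\<le>independence_number G. monom (of_nat (num_independent_sets G i)) i)"

definition lex_product ::
    "'a pair_pre_digraph \<Rightarrow> 'b pair_pre_digraph \<Rightarrow> ('a \<times> 'b) pair_pre_digraph" where
  "lex_product G H =
     \<lparr> pverts = pverts G \<times> pverts H,
       parcs = {((a, x), (b, y)) | a x b y.
                  a \<in> pverts G \<and> b \<in> pverts G \<and> x \<in> pverts H \<and> y \<in> pverts H \<and>
                  ((a, b) \<in> parcs G \<or> a = b \<and> (x, y) \<in> parcs H)} \<rparr>"

definition relabel :: "('a \<Rightarrow> 'b) \<Rightarrow> 'a pair_pre_digraph \<Rightarrow> 'b pair_pre_digraph" where
  "relabel f G = \<lparr> pverts = f ` pverts G, parcs = map_prod f f ` parcs G \<rparr>"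

text \<open>
  The iterated product has vertices in a type that grows with \<open>m\<close>.  To keep all powers in one
  type, the nested pair \<open>(v\<^sub>1, (v\<^sub>2, \<dots>))\<close> is renamed to the list \<open>[v\<^sub>1, v\<^sub>2, \<dots>]\<close> of length \<open>m\<close>.
  The power \<open>m = 0\<close> is the one-vertex graph, which is neutral for the product, so that \<open>m = 1\<close>
  gives a copy of \<open>G\<close>.
\<close>

primrec lex_power :: "'a pair_pre_digraph \<Rightarrow> nat \<Rightarrow> 'a list pair_pre_digraph" where
  "lex_power G 0 = \<lparr> pverts = {[]}, parcs = {} \<rparr>"
| "lex_power G (Suc m) = relabel (\<lambda>(v, vs). v # vs) (lex_product G (lex_power G m))"

definition Roots :: "complex poly \<Rightarrow> complex set" where
  "Roots p = {z. poly p z = 0}"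

text \<open>The Hausdorff distance; meaningful for nonempty bounded sets only.\<close>

definition hausdorff_dist :: "'a::metric_space set \<Rightarrow> 'a set \<Rightarrow> real" where
  "hausdorff_dist A B = max (SUP a\<in>A. infdist a B) (SUP b\<in>B. infdist b A)"

definition hausdorff_limit :: "(nat \<Rightarrow> 'a::metric_space set) \<Rightarrow> 'a set \<Rightarrow> bool" where
  "hausdorff_limit X A \<longleftrightarrow>
     A \<noteq> {} \<and> compact A \<and> (\<lambda>m. hausdorff_dist (X m) A) \<longlonglongrightarrow> 0"

definition independence_attractor :: "'a pair_pre_digraph \<Rightarrow> complex set" where
  "independence_attractor G =
     (THE A. hausdorff_limit (\<lambda>m. Roots (independence_poly (lex_power G m))) A)"

definition totally_disconnected :: "'a::topological_space set \<Rightarrow> bool" where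
  "totally_disconnected S \<longleftrightarrow> (\<forall>C\<in>components S. \<exists>x. C = {x})"

end

theory Submission
  imports Defs "HOL-Complex_Analysis.Complex_Analysis"
begin

text \<open>
  Since \<open>I\<^bsub>G[H]\<^esub>(z) = I\<^bsub>G\<^esub>(I\<^bsub>H\<^esub>(z) - 1)\<close>, the roots of \<open>I\<^bsub>G\<^sup>m\<^esub>\<close> are the \<open>m\<close>-th preimages of \<open>-1\<close> under the cubic
  \<open>f = I\<^bsub>G\<^esub> - 1\<close>.  The condition \<open>a\<^sub>2\<^sup>2 < 3 a\<^sub>1 a\<^sub>3\<close> says that the critical points of \<open>f\<close> are not real; after an
  affine change of variable an explicit estimate shows that each critical value, or its first image, lies
  beyond an escape radius.  Hence a neighbourhood \<open>U\<close> of the filled Julia set \<open>K\<close>, namely a preimage of a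
  large disc, contains no critical value.  The components of \<open>U\<close> are simply connected, so inverse
  branches of all iterates exist on them, and by normality their images shrink uniformly.  This makes
  \<open>K\<close> totally disconnected, and it makes the preimages of any point of the disc converge to \<open>K\<close>.
\<close>

section \<open>Independence polynomials of lexicographic powers\<close>

definition indep_sets :: "'a pair_pre_digraph \<Rightarrow> 'a set set" where
  "indep_sets G = {S. independent_set G S}"

lemma finite_indep_sets: "finite (pverts G) \<Longrightarrow> finite (indep_sets G)"
  unfolding indep_sets_def independent_set_def
  by (rule finite_subset[of _ "Pow (pverts G)"]) auto

lemma empty_in_indep_sets: "{} \<in> indep_sets G"
  by (simp add: indep_sets_def independent_set_def)

lemma finite_indep_set: "\<lbrakk>finite (pverts G); S \<in> indep_sets G\<rbrakk> \<Longrightarrow> finite S"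
  unfolding indep_sets_def independent_set_def using finite_subset by blast

text \<open>Sorting the sets by size gives this form; as a sum over the sets themselves the
  polynomial can be expanded fibre by fibre over a product.\<close>

lemma poly_independence_poly:
  assumes "finite (pverts G)"
  shows "poly (independence_poly G) z = (\<Sum>S\<in>indep_sets G. z ^ card S)"
proof -
  let ?I = "indep_sets G"
  have fin: "finite ?I" using assms by (rule finite_indep_sets)
  have le: "card S \<le> independence_number G" if "S \<in> ?I" for S
    unfolding independence_number_def
    using fin that by (intro Max_ge) (auto simp: indep_sets_def)
  have "(\<Sum>S\<in>?I. z ^ card S) = (\<Sum>i\<le>independence_number G. \<Sum>S\<in>{S\<in>?I. card S = i}. z ^ card S)"
    using fin le by (intro sum.group[symmetric]) auto
  also have "\<dots> = (\<Sum>i\<le>independence_number G. of_nat (num_independent_sets G i) * z ^ i)"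
    by (intro sum.cong refl) (simp add: num_independent_sets_def indep_sets_def)
  also have "\<dots> = poly (independence_poly G) z"
    by (simp add: independence_poly_def poly_sum poly_monom)
  finally show ?thesis by simp
qed

lemma indep_sets_relabel:
  assumes f: "inj f"
  shows "indep_sets (relabel f G) = (\<lambda>S. f ` S) ` indep_sets G"
proof -
  have arcs: "(f u, f v) \<in> parcs (relabel f G) \<longleftrightarrow> (u, v) \<in> parcs G" for u v
    using inj_image_mem_iff[OF prod.inj_map[OF f f], of "(u, v)" "parcs G"] by (simp add: relabel_def)
  have ind: "independent_set (relabel f G) (f ` S) \<longleftrightarrow> independent_set G S" for S
    using f by (simp add: independent_set_def pairwise_image pairwise_def arcs inj_eq)
      (simp add: relabel_def inj_image_subset_iff)
  show ?thesis
  proof (intro equalityI subsetI)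
    fix T assume T: "T \<in> indep_sets (relabel f G)"
    then have "T \<subseteq> f ` pverts G" by (simp add: indep_sets_def independent_set_def relabel_def)
    then obtain S where "T = f ` S" by (meson subset_imageE)
    then show "T \<in> (\<lambda>S. f ` S) ` indep_sets G" using T ind by (auto simp: indep_sets_def)
  qed (use ind in \<open>auto simp: indep_sets_def\<close>)
qed

lemma sum_indep_sets_relabel:
  assumes f: "inj f"
  shows "(\<Sum>S\<in>indep_sets (relabel f G). z ^ card S) = (\<Sum>S\<in>indep_sets G. z ^ card S)"
  unfolding indep_sets_relabel[OF f]
  using f by (subst sum.reindex) (auto simp: inj_on_def inj_image_eq_iff card_image inj_on_subset)

lemma independent_set_lex_product:
  assumes loopfree: "\<And>v. (v, v) \<notin> parcs G"
  shows "independent_set (lex_product G H) S \<longleftrightarrow>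
    independent_set G (fst ` S) \<and> (\<forall>a\<in>fst ` S. independent_set H (S `` {a}))" (is "?L \<longleftrightarrow> ?R")
proof
  assume ?L
  then have sub: "S \<subseteq> pverts G \<times> pverts H"
    and ind: "\<And>a x b y. \<lbrakk>(a, x) \<in> S; (b, y) \<in> S; (a, x) \<noteq> (b, y)\<rbrakk> \<Longrightarrow>
        (a, b) \<notin> parcs G \<and> \<not> (a = b \<and> (x, y) \<in> parcs H)"
    by (auto simp: independent_set_def lex_product_def pairwise_def) blast+
  show ?R
    using sub ind by (fastforce simp: independent_set_def pairwise_def)
next
  assume R: ?R
  have sub: "S \<subseteq> pverts G \<times> pverts H" using R by (force simp: independent_set_def)
  have "((a, x), (b, y)) \<notin> parcs (lex_product G H)"
    if S: "(a, x) \<in> S" "(b, y) \<in> S" "(a, x) \<noteq> (b, y)" for a x b y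
  proof (cases "a = b")
    case True
    then have "x \<in> S `` {a}" "y \<in> S `` {a}" "x \<noteq> y" using S by auto
    moreover have "independent_set H (S `` {a})" using R S(1) by force
    ultimately have "(x, y) \<notin> parcs H" by (auto simp: independent_set_def pairwise_def)
    \<comment> \<open>A loop at \<open>a\<close> in \<open>G\<close> would join any two points of
      the fibre over \<open>a\<close>.\<close>
    then show ?thesis using True loopfree by (simp add: lex_product_def)
  next
    case False
    moreover have "a \<in> fst ` S" "b \<in> fst ` S" using S by force+
    ultimately have "(a, b) \<notin> parcs G" using R by (auto simp: independent_set_def pairwise_def)
    then show ?thesis using False by (simp add: lex_product_def)
  qed
  then have "pairwise (\<lambda>u v. (u, v) \<notin> parcs (lex_product G H)) S" by (auto simp: pairwise_def)
  then show ?L using sub by (simp add: independent_set_def lex_product_def)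
qed

text \<open>An independent set of the product is an independent set of \<open>G\<close> together with a nonempty
  independent set of \<open>H\<close> over each of its points.\<close>

lemma poly_independence_poly_lex_product:
  assumes fin: "finite (pverts G)" "finite (pverts H)" and loopfree: "\<And>v. (v, v) \<notin> parcs G"
  shows "poly (independence_poly (lex_product G H)) z =
    poly (independence_poly G) (poly (independence_poly H) z - 1)"
proof -
  let ?N = "indep_sets H - {{}}"
  have finN: "finite ?N" using finite_indep_sets[OF fin(2)] by simp
  have finS: "finite A" if "A \<in> indep_sets G" for A using finite_indep_set[OF fin(1) that] .
  have "poly (independence_poly H) z = (\<Sum>S\<in>insert {} ?N. z ^ card S)"
    using fin(2) by (simp add: poly_independence_poly insert_absorb[OF empty_in_indep_sets])
  also have "\<dots> = 1 + (\<Sum>S\<in>?N. z ^ card S)" using finN by (subst sum.insert) auto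
  finally have H: "poly (independence_poly H) z - 1 = (\<Sum>S\<in>?N. z ^ card S)" by simp
  have "finite (pverts (lex_product G H))" using fin by (simp add: lex_product_def)
  then have "poly (independence_poly (lex_product G H)) z =
      (\<Sum>S\<in>indep_sets (lex_product G H). z ^ card S)"
    by (rule poly_independence_poly)
  \<comment> \<open>\<open>S\<close> corresponds to its projection together with its fibre map.
    Restricting the fibre map to the projection makes it extensional, hence unique; excluding empty
    fibres makes \<open>A\<close> recoverable from \<open>Sigma A g\<close>.\<close>
  also have "\<dots> = (\<Sum>(A, g)\<in>(SIGMA A:indep_sets G. A \<rightarrow>\<^sub>E ?N). z ^ card (Sigma A g))"
  proof (rule sum.reindex_bij_witness[of _ "\<lambda>(A, g). Sigma A g"
        "\<lambda>S. (fst ` S, \<lambda>a\<in>fst ` S. S `` {a})"])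
    fix S assume "S \<in> indep_sets (lex_product G H)"
    then have S: "independent_set G (fst ` S)" "\<forall>a\<in>fst ` S. independent_set H (S `` {a})"
      by (simp_all add: indep_sets_def independent_set_lex_product[OF loopfree])
    show eq: "(case (fst ` S, \<lambda>a\<in>fst ` S. S `` {a}) of (A, g) \<Rightarrow> Sigma A g) = S"
      by (force split: if_splits)
    show "(fst ` S, \<lambda>a\<in>fst ` S. S `` {a}) \<in> (SIGMA A:indep_sets G. A \<rightarrow>\<^sub>E ?N)"
    proof (intro SigmaI PiE_I)
      show "fst ` S \<in> indep_sets G" using S(1) by (simp add: indep_sets_def)
      show "(\<lambda>a\<in>fst ` S. S `` {a}) a \<in> ?N" if "a \<in> fst ` S" for a
      proof -
        have "S `` {a} \<noteq> {}" using that by force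
        then show ?thesis using S(2)[rule_format, OF that] that by (simp add: indep_sets_def)
      qed
    qed simp
    show "(case (fst ` S, \<lambda>a\<in>fst ` S. S `` {a}) of (A, g) \<Rightarrow> z ^ card (Sigma A g)) = z ^ card S"
      using eq by simp
  next
    fix Ag assume "Ag \<in> (SIGMA A:indep_sets G. A \<rightarrow>\<^sub>E ?N)"
    then obtain A g where Ag: "Ag = (A, g)" "A \<in> indep_sets G" "g \<in> A \<rightarrow>\<^sub>E ?N" by blast
    then have ne: "\<And>a. a \<in> A \<Longrightarrow> g a \<noteq> {}" and gi: "\<And>a. a \<in> A \<Longrightarrow> g a \<in> indep_sets H" by auto
    have fst: "fst ` Sigma A g = A" using ne by force
    have im: "Sigma A g `` {a} = g a" if "a \<in> A" for a using that by auto
    have "(\<lambda>a\<in>A. Sigma A g `` {a}) = g"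
      using Ag(3) im by (intro extensionalityI[of _ A]) (auto simp: PiE_iff)
    then show "(fst ` (case Ag of (A, g) \<Rightarrow> Sigma A g), \<lambda>a\<in>fst ` (case Ag of (A, g) \<Rightarrow> Sigma A g).
        (case Ag of (A, g) \<Rightarrow> Sigma A g) `` {a}) = Ag"
      unfolding Ag(1) prod.case fst by simp
    show "(case Ag of (A, g) \<Rightarrow> Sigma A g) \<in> indep_sets (lex_product G H)"
      using Ag(2) gi im unfolding Ag(1) prod.case
      by (simp add: indep_sets_def independent_set_lex_product[OF loopfree] fst)
  qed
  also have "\<dots> = (\<Sum>A\<in>indep_sets G. \<Sum>g\<in>A \<rightarrow>\<^sub>E ?N. z ^ card (Sigma A g))"
    using finite_indep_sets[OF fin(1)] finS finN
    by (subst sum.Sigma) (auto intro!: finite_PiE)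
  also have "\<dots> = (\<Sum>A\<in>indep_sets G. \<Sum>g\<in>A \<rightarrow>\<^sub>E ?N. \<Prod>a\<in>A. z ^ card (g a))"
  proof (intro sum.cong refl)
    fix A g assume "A \<in> indep_sets G" "g \<in> A \<rightarrow>\<^sub>E ?N"
    moreover from this have "finite (g a)" if "a \<in> A" for a
      using that finite_indep_set[OF fin(2)] by auto
    ultimately show "z ^ card (Sigma A g) = (\<Prod>a\<in>A. z ^ card (g a))"
      using finS by (simp add: power_sum)
  qed
  \<comment> \<open>Distributive law: summing over all choices of fibres leaves one factor I_H(z) -
    1 for each point of \<open>A\<close>.\<close>
  also have "\<dots> = (\<Sum>A\<in>indep_sets G. \<Prod>a\<in>A. \<Sum>S\<in>?N. z ^ card S)"
    using finS finN by (intro sum.cong refl prod_sum_PiE[symmetric]) auto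
  also have "\<dots> = poly (independence_poly G) (poly (independence_poly H) z - 1)"
    by (simp add: H poly_independence_poly[OF fin(1)])
  finally show ?thesis .
qed

lemma finite_lex_power: "finite (pverts G) \<Longrightarrow> finite (pverts (lex_power G m))"
  by (induction m) (auto simp: relabel_def lex_product_def)

text \<open>Subtracting 1 turns the substitution rule for products into composition. The one-vertex
  graph has polynomial 1 + z, which matches the identity map at \<open>m = 0\<close>.\<close>

lemma poly_independence_poly_lex_power:
  assumes fin: "finite (pverts G)" and loopfree: "\<And>v. (v, v) \<notin> parcs G"
  shows "poly (independence_poly (lex_power G m)) z =
    ((\<lambda>z. poly (independence_poly G) z - 1) ^^ m) z + 1"
proof (induction m)
  case 0
  have "indep_sets (lex_power G 0) = {{}, {[]}}"
    by (auto simp: indep_sets_def independent_set_def subset_singleton_iff)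
  then show ?case by (simp add: poly_independence_poly)
next
  case (Suc m)
  have inj: "inj (\<lambda>(v, vs). v # vs)" by (auto simp: inj_def)
  note finm = finite_lex_power[OF fin, of m]
  have finl: "finite (pverts (lex_product G (lex_power G m)))"
    using fin finm by (simp add: lex_product_def)
  have "poly (independence_poly (lex_power G (Suc m))) z =
      poly (independence_poly (lex_product G (lex_power G m))) z"
    using finite_lex_power[OF fin, of "Suc m"] finl inj
    by (simp add: poly_independence_poly sum_indep_sets_relabel[OF inj])
  then show ?case
    by (simp add: poly_independence_poly_lex_product[OF fin finm loopfree] Suc)
qed

section \<open>Bounds on the numbers of independent sets\<close>

lemma num_independent_sets_le:
  assumes "finite (pverts G)"
  shows "num_independent_sets G k \<le> card (pverts G) choose k"
proof -
  have "{S. independent_set G S \<and> card S = k} \<subseteq> {S. S \<subseteq> pverts G \<and> card S = k}"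
    by (auto simp: independent_set_def)
  then have "num_independent_sets G k \<le> card {S. S \<subseteq> pverts G \<and> card S = k}"
    unfolding num_independent_sets_def using assms by (intro card_mono) auto
  then show ?thesis using n_subsets[OF assms] by simp
qed

lemma choose_le_num_independent_sets:
  assumes "finite (pverts G)" "independent_set G S"
  shows "card S choose k \<le> num_independent_sets G k"
proof -
  have "finite S" using assms by (auto simp: independent_set_def dest: finite_subset)
  then have "card S choose k = card {T. T \<subseteq> S \<and> card T = k}" by (simp add: n_subsets)
  moreover have "{T. T \<subseteq> S \<and> card T = k} \<subseteq> {S. independent_set G S \<and> card S = k}"
    using assms(2) by (auto simp: independent_set_def intro: pairwise_subset)
  moreover have "finite {S. independent_set G S \<and> card S = k}"
    using finite_indep_sets[OF assms(1)] unfolding indep_sets_def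
    by (rule rev_finite_subset) auto
  ultimately show ?thesis
    unfolding num_independent_sets_def by (simp add: card_mono)
qed

lemma num_independent_sets_1:
  assumes "\<And>v. (v, v) \<notin> parcs G"
  shows "num_independent_sets G 1 = card (pverts G)"
proof -
  have "{S. independent_set G S \<and> card S = 1} = (\<lambda>v. {v}) ` pverts G"
    by (auto simp: independent_set_def card_1_singleton_iff)
  then show ?thesis unfolding num_independent_sets_def by (simp add: card_image)
qed

lemma independence_number_attained:
  assumes "finite (pverts G)"
  shows "\<exists>S. independent_set G S \<and> card S = independence_number G"
proof -
  have "independence_number G \<in> card ` {S. independent_set G S}"
    unfolding independence_number_def
    using finite_indep_sets[OF assms] empty_in_indep_sets[of G] unfolding indep_sets_def
    by (intro Max_in) auto
  then show ?thesis by auto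
qed

lemma coeff_independence_poly:
  "i \<le> independence_number G \<Longrightarrow> coeff (independence_poly G) i = of_nat (num_independent_sets G i)"
  by (simp add: independence_poly_def coeff_sum)

text \<open>An independent triple gives \<open>a2 \<ge> 3\<close>. With three vertices
  \<open>a3 \<le> 1\<close>, which contradicts \<open>disc\<close>. With four vertices
  \<open>a3 \<le> 4\<close>, and the finitely many pairs with \<open>a2^2 < 12 * a3\<close> all
  satisfy \<open>a2^2 \<le> 9 * a3\<close>. That sharper bound later gives \<open>1 \<le> p\<close>
  for the linear coefficient \<open>p\<close> of the depressed cubic.\<close>

lemma independence_number_3_bounds:
  fixes a1 a2 a3 :: nat
  assumes "pair_graph G" "independence_number G = 3"
    and I: "independence_poly G = [:1, of_nat a1, of_nat a2, of_nat a3:]"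
    and disc: "a2^2 < 3 * a1 * a3"
  shows "1 \<le> a3" "5 \<le> a1 \<or> a1 = 4 \<and> a2^2 \<le> 9 * a3"
proof -
  interpret pair_graph G by fact
  have fin: "finite (pverts G)" by (rule pair_finite_verts)
  have loop: "\<And>v. (v, v) \<notin> parcs G" using pair_no_loops by fastforce
  have c: "of_nat (num_independent_sets G i) = coeff [:1, of_nat a1, of_nat a2, of_nat a3 :: complex:] i"
    if "i \<le> 3" for i :: nat
    using coeff_independence_poly[of i G] that assms(2) I by simp
  have n: "num_independent_sets G 1 = a1" "num_independent_sets G 2 = a2" "num_independent_sets G 3 = a3"
    using c[of 1] c[of 2] c[of 3] by (simp_all add: numeral_2_eq_2 numeral_3_eq_3)
  obtain S where S: "independent_set G S" "card S = 3"
    using independence_number_attained[OF fin] assms(2) by auto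
  have "3 choose 1 \<le> a1" "3 choose 2 \<le> a2" "3 choose 3 \<le> a3"
    using choose_le_num_independent_sets[OF fin S(1)] n S(2) by metis+
  then have low: "3 \<le> a1" "3 \<le> a2" "1 \<le> a3" by (simp_all add: numeral_2_eq_2 numeral_3_eq_3)
  then show "1 \<le> a3" by simp
  have a3: "a3 \<le> a1 choose 3"
    using num_independent_sets_le[OF fin, of 3] n num_independent_sets_1[OF loop] by simp
  consider "a1 = 3" | "a1 = 4" | "5 \<le> a1" using low by linarith
  then show "5 \<le> a1 \<or> a1 = 4 \<and> a2^2 \<le> 9 * a3"
  proof cases
    case 1
    then have "a2^2 < 9" using a3 low disc by simp
    moreover have "3^2 \<le> a2^2" using low by (intro power_mono) auto
    ultimately show ?thesis by simp
  next
    case 2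
    then have a3: "a3 \<le> 4" using a3 by (simp add: numeral_eq_Suc)
    have d: "a2^2 < 12 * a3" using disc 2 by simp
    also have "\<dots> < 7^2" using a3 by simp
    finally have "a2 < 7" by (rule power_less_imp_less_base) simp
    then have "a2 \<in> {0..6}" "a3 \<in> {0..4}" using a3 by auto
    then have "a2^2 \<le> 9 * a3"
      using d by (auto simp: numeral_eq_Suc atLeast0_atMost_Suc)
    then show ?thesis using 2 by simp
  qed simp
qed

section \<open>Hausdorff limits\<close>

text \<open>Boundedness makes the supremum a genuine upper bound; for an unbounded set of reals
  \<open>SUP\<close> carries no information.\<close>

lemma infdist_le_hausdorff_dist:
  assumes "bounded A" "bounded B" "B \<noteq> {}" "a \<in> A"
  shows "infdist a B \<le> hausdorff_dist A B"
proof -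
  obtain b where b: "b \<in> B" using assms(3) by blast
  obtain e where e: "\<And>x. x \<in> A \<Longrightarrow> dist b x \<le> e" using bounded_any_center assms(1) by metis
  have "infdist x B \<le> e" if "x \<in> A" for x
    using infdist_le[OF b, of x] e[OF that] by (simp add: dist_commute)
  then have "bdd_above ((\<lambda>x. infdist x B) ` A)" by (rule bdd_aboveI2)
  then have "infdist a B \<le> (SUP x\<in>A. infdist x B)" using assms(4) by (intro cSUP_upper)
  then show ?thesis by (simp add: hausdorff_dist_def)
qed

lemma hausdorff_dist_commute: "hausdorff_dist A B = hausdorff_dist B A"
  by (simp add: hausdorff_dist_def max.commute)

lemma hausdorff_dist_le:
  assumes "A \<noteq> {}" "B \<noteq> {}" "\<And>a. a \<in> A \<Longrightarrow> infdist a B \<le> e" "\<And>b. b \<in> B \<Longrightarrow> infdist b A \<le> e"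
  shows "hausdorff_dist A B \<le> e"
  unfolding hausdorff_dist_def using assms by (simp add: cSUP_least)

text \<open>Used in both directions, this is uniqueness of the limit, which the \<open>THE\<close>
  in \<open>independence_attractor\<close> requires. A point of \<open>A\<close> is near some point
  of \<open>X m\<close>, which in turn is near \<open>B\<close>.\<close>

lemma hausdorff_limit_subset:
  assumes A: "hausdorff_limit X A" and B: "hausdorff_limit X B"
    and X: "\<And>m. X m \<noteq> {}" "\<And>m. bounded (X m)"
  shows "A \<subseteq> B"
proof
  fix x assume x: "x \<in> A"
  have bA: "bounded A" "A \<noteq> {}" and bB: "compact B" "B \<noteq> {}"
    using A B by (auto simp: hausdorff_limit_def compact_imp_bounded)
  have "infdist x B \<le> 0"
  proof (rule tendsto_lowerbound)
    have "(\<lambda>m. hausdorff_dist (X m) A + hausdorff_dist (X m) B) \<longlonglongrightarrow> 0 + 0"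
      using A B unfolding hausdorff_limit_def by (intro tendsto_add) auto
    then show "(\<lambda>m. hausdorff_dist (X m) A + hausdorff_dist (X m) B) \<longlonglongrightarrow> 0" by simp
    have "infdist x B \<le> hausdorff_dist (X m) A + hausdorff_dist (X m) B" for m
    \<comment> \<open>The infimum defining \<open>infdist x (X m)\<close> need not be attained, so a
      point within \<open>e\<close> of it is used.\<close>
    proof (rule field_le_epsilon)
      fix e :: real assume e: "0 < e"
      have "infdist x (X m) < infdist x (X m) + e" using e by simp
      then obtain y where y: "y \<in> X m" "dist x y < infdist x (X m) + e"
        using infdist_le2 X(1)[of m] by (metis (no_types, lifting) cInf_lessD empty_is_image imageE infdist_notempty)
      have "infdist x B \<le> infdist y B + dist x y" by (rule infdist_triangle)
      moreover have "infdist y B \<le> hausdorff_dist (X m) B"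
        using infdist_le_hausdorff_dist[OF X(2) _ bB(2) y(1)] bB(1) compact_imp_bounded by blast
      moreover have "infdist x (X m) \<le> hausdorff_dist (X m) A"
        using infdist_le_hausdorff_dist[OF bA(1) X(2) X(1) x] by (simp add: hausdorff_dist_commute)
      ultimately show "infdist x B \<le> hausdorff_dist (X m) A + hausdorff_dist (X m) B + e"
        using y(2) by linarith
    qed
    then show "eventually (\<lambda>m. infdist x B \<le> hausdorff_dist (X m) A + hausdorff_dist (X m) B) sequentially"
      by simp
  qed simp
  then have "infdist x B = 0" using infdist_nonneg[of x B] by linarith
  then show "x \<in> B" using bB in_closed_iff_infdist_zero compact_imp_closed by metis
qed

lemma hausdorff_limitI:
  assumes A: "A \<noteq> {}" "compact A" and X: "\<And>m. X m \<noteq> {}" "\<And>m. bounded (X m)"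
    and near: "\<And>e. 0 < e \<Longrightarrow> eventually (\<lambda>m. \<forall>x\<in>X m. infdist x A < e) sequentially"
      "\<And>e. 0 < e \<Longrightarrow> eventually (\<lambda>m. \<forall>a\<in>A. \<exists>x\<in>X m. dist a x < e) sequentially"
  shows "hausdorff_limit X A"
  unfolding hausdorff_limit_def
proof (intro conjI A)
  have nonneg: "0 \<le> hausdorff_dist (X m) A" for m
    using infdist_le_hausdorff_dist[OF X(2) compact_imp_bounded[OF A(2)] A(1)] X(1)[of m]
    by (meson all_not_in_conv infdist_nonneg order_trans)
  show "(\<lambda>m. hausdorff_dist (X m) A) \<longlonglongrightarrow> 0"
  proof (rule tendstoI)
    fix e :: real assume "0 < e"
    then have e: "0 < e/2" by simp
    show "eventually (\<lambda>m. dist (hausdorff_dist (X m) A) 0 < e) sequentially"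
      using near(1)[OF e] near(2)[OF e]
    proof eventually_elim
      case (elim m)
      have "infdist a (X m) \<le> e/2" if "a \<in> A" for a
        using elim(2) that infdist_le2[of _ "X m" a "e/2"] by (meson less_imp_le)
      then have "hausdorff_dist (X m) A \<le> e/2"
        using elim(1) by (intro hausdorff_dist_le X(1) A(1)) auto
      then show ?case using nonneg[of m] e by (simp add: dist_real_def)
    qed
  qed
qed

section \<open>Entire maps whose critical values escape\<close>

text \<open>By the maximum modulus principle \<open>norm F\<close> stays below \<open>R\<close> on
  the inside of any closed path in \<open>W\<close>. The inside is therefore part of the same
  component, and a point not in \<open>W\<close> lies outside the path, where the winding number is
  zero.\<close>

lemma simply_connected_component_norm_less:
  fixes F :: "complex \<Rightarrow> complex"
  assumes F: "F holomorphic_on UNIV" and W: "W \<in> components {z. norm (F z) < R}"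
  shows "simply_connected W"
proof -
  have contF: "continuous_on A F" for A
    using F holomorphic_on_imp_continuous_on holomorphic_on_subset by blast
  have op: "open {z. norm (F z) < R}"
    using contF[of UNIV] by (intro open_Collect_less continuous_intros)
  have oW: "open W" using W op open_components by blast
  have "winding_number g z = 0"
    if g: "path g" "path_image g \<subseteq> W" "pathfinish g = pathstart g" "z \<notin> W" for g z
  proof -
    let ?I = "inside (path_image g)"
    have cp: "compact (path_image g)" using g by (simp add: compact_path_image)
    have cl: "closed (path_image g)" using cp by (rule compact_imp_closed)
    obtain \<xi> where \<xi>: "\<xi> \<in> path_image g"
      "\<And>y. y \<in> path_image g \<Longrightarrow> norm (F y) \<le> norm (F \<xi>)"
      using continuous_attains_sup[OF cp path_image_nonempty, of "\<lambda>z. norm (F z)"] contF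
      by (metis continuous_on_norm)
    have lt: "norm (F \<xi>) < R"
      using \<xi>(1) g(2) W in_components_subset by blast
    have "norm (F y) \<le> norm (F \<xi>)" if "y \<in> ?I" for y
    proof (rule maximum_modulus_frontier[of F ?I])
      show "F holomorphic_on interior ?I" using F holomorphic_on_subset by blast
      show "continuous_on (closure ?I) F" by (rule contF)
      show "bounded ?I" using cp by (simp add: bounded_inside compact_imp_bounded)
      show "norm (F w) \<le> norm (F \<xi>)" if "w \<in> frontier ?I" for w
        using that frontier_inside_subset[OF cl] \<xi>(2) by blast
    qed (use that in auto)
    then have sub: "path_image g \<union> ?I \<subseteq> {z. norm (F z) < R}"
      using lt \<xi>(2) by fastforce
    have "connected (path_image g \<union> ?I)"
      by (rule connected_with_inside[OF cl connected_path_image[OF g(1)]])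
    then have "path_image g \<union> ?I \<subseteq> W"
      using components_maximal[OF W _ sub] g(2) path_image_nonempty by blast
    then have "z \<in> outside (path_image g)"
      using g(4) inside_Un_outside[of "path_image g"] by blast
    then show ?thesis using g by (simp add: winding_number_zero_in_outside)
  qed
  then show ?thesis
    using simply_connected_eq_winding_number_zero[OF oW] in_components_connected[OF W] by blast
qed

text \<open>The image is open by the open mapping theorem and relatively closed because
  \<open>closure W\<close> is compact, so it is the whole connected ball.\<close>

lemma component_norm_less_image:
  fixes F :: "complex \<Rightarrow> complex"
  assumes F: "F holomorphic_on UNIV" and bd: "bounded {z. norm (F z) < R}"
    and W: "W \<in> components {z. norm (F z) < R}"
  shows "F ` W = ball 0 R"
proof -
  let ?U = "{z. norm (F z) < R}"
  have contF: "continuous_on A F" for A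
    using F holomorphic_on_imp_continuous_on holomorphic_on_subset by blast
  have op: "open ?U"
    using contF[of UNIV] by (intro open_Collect_less continuous_intros)
  have oW: "open W" using W op open_components by blast
  have ne: "W \<noteq> {}" using W in_components_nonempty by blast
  have sub: "W \<subseteq> ?U" using W in_components_subset by blast
  have nc: "\<not> F constant_on UNIV"
  proof
    assume "F constant_on UNIV"
    then obtain c where c: "\<And>x. F x = c" by (auto simp: constant_on_def)
    then have "?U = UNIV" using ne sub by auto
    then show False using bd by simp
  qed
  have o: "open (F ` W)"
    using open_mapping_thm[OF F open_UNIV connected_UNIV oW _ nc] by simp
  have "F ` W \<subseteq> ball 0 R" using sub by auto
  moreover have "ball 0 R \<subseteq> F ` W"
  proof -
    have "bounded (closure W)" using bounded_subset[OF bd sub] by (rule bounded_closure)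
    then have "compact (closure W)" by (simp add: compact_eq_bounded_closed)
    then have cl: "closed (F ` closure W)"
      using compact_continuous_image[OF contF] compact_imp_closed by blast
    \<comment> \<open>\<open>W\<close> is closed in the sublevel set, so \<open>closure W\<close>
      adds only points with \<open>norm (F z) \<ge> R\<close>, whose images miss the ball.\<close>
    obtain T where T: "closed T" "W = ?U \<inter> T"
      using closedin_component[OF W] unfolding closedin_closed by blast
    then have "closure W \<subseteq> T" by (simp add: closure_minimal)
    then have "F ` W = ball 0 R \<inter> F ` closure W"
      using T(2) sub closure_subset[of W] by auto
    then have "closedin (top_of_set (ball 0 R)) (F ` W)"
      using cl closedin_closed by blast
    moreover have "openin (top_of_set (ball 0 R)) (F ` W)"
      using o sub by (intro open_subset) auto
    ultimately have "F ` W = {} \<or> F ` W = ball 0 R"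
      using connected_ball[of 0 R] unfolding connected_clopen by blast
    then show ?thesis using ne by auto
  qed
  ultimately show ?thesis by blast
qed

text \<open>\<open>V\<close> stands for the critical values. They enter only through
  \<open>branch\<close>: over a simply connected open set avoiding \<open>V\<close>, an inverse
  branch exists through any prescribed preimage. The fixed point 0 keeps the filled Julia set
  nonempty.\<close>

locale escaping_map =
  fixes f :: "complex \<Rightarrow> complex" and V :: "complex set" and R :: real
  assumes holo: "f holomorphic_on UNIV"
    and R_pos: "0 < R"
    and escape: "R \<le> norm z \<Longrightarrow> 2 * norm z \<le> norm (f z)"
    and fix0: "f 0 = 0"
    and branch: "\<lbrakk>open W; simply_connected W; W \<inter> V = {}; f z \<in> W\<rbrakk> \<Longrightarrow>
                   \<exists>h. h holomorphic_on W \<and> (\<forall>w\<in>W. f (h w) = w) \<and> h (f z) = z"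
    and finV: "finite V"
    and V_escape: "v \<in> V \<Longrightarrow> \<exists>n. R \<le> norm ((f ^^ n) v)"
begin

section \<open>Sublevel sets and the filled Julia set\<close>

definition U :: "nat \<Rightarrow> complex set" where "U n = {z. norm ((f ^^ n) z) < R}"

text \<open>The filled Julia set: an orbit that once reaches norm \<open>R\<close> never drops below
  it again.\<close>

definition K :: "complex set" where "K = (\<Inter>n. U n)"

lemma holo_iter: "(f ^^ n) holomorphic_on UNIV"
proof (induction n)
  case 0 then show ?case by (simp add: id_def)
next
  case (Suc n)
  have "f \<circ> (f ^^ n) holomorphic_on UNIV"
    by (rule holomorphic_on_compose) (use Suc holo holomorphic_on_subset in auto)
  then show ?case by (simp add: o_def)
qed

lemma cont_iter: "continuous_on A (f ^^ n)"
  using holo_iter holomorphic_on_imp_continuous_on holomorphic_on_subset by blast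

lemma open_U: "open (U n)"
  unfolding U_def by (intro open_Collect_less continuous_intros cont_iter)

lemma escape_iter: "R \<le> norm z \<Longrightarrow> norm z \<le> norm ((f ^^ n) z)"
proof (induction n)
  case (Suc n)
  then have "2 * norm ((f ^^ n) z) \<le> norm ((f ^^ Suc n) z)" by (simp add: escape)
  moreover have "norm z \<le> norm ((f ^^ n) z)" using Suc by blast
  ultimately show ?case using norm_ge_zero[of "(f ^^ n) z"] by linarith
qed simp

lemma cl_U_subset: "{z. norm ((f ^^ n) z) \<le> R} \<subseteq> cball 0 R"
proof
  fix z assume "z \<in> {z. norm ((f ^^ n) z) \<le> R}"
  then show "z \<in> cball 0 R" using escape_iter[of z n] by (cases "R \<le> norm z") auto
qed

lemma U_subset_ball: "U n \<subseteq> ball 0 R"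
proof
  fix z assume "z \<in> U n"
  then show "z \<in> ball 0 R" using escape_iter[of z n] by (cases "R \<le> norm z") (auto simp: U_def)
qed

text \<open>If an iterate has norm at least \<open>R\<close>, the next one has norm at least
  \<open>2 * R\<close>. Open and closed sublevel sets thus interleave, and \<open>K\<close> becomes
  an intersection of compact sets.\<close>

lemma cl_U_Suc_subset: "{z. norm ((f ^^ Suc n) z) \<le> R} \<subseteq> U n"
proof -
  have "norm ((f ^^ n) z) < R" if "norm (f ((f ^^ n) z)) \<le> R" for z
    using escape[of "(f ^^ n) z"] that R_pos by (smt (verit))
  then show ?thesis by (auto simp: U_def)
qed

lemma U_mono: "m \<le> n \<Longrightarrow> U n \<subseteq> U m"
proof (rule lift_Suc_antimono_le[of U])
  show "U (Suc n) \<subseteq> U n" for n using cl_U_Suc_subset[of n] by (force simp: U_def)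
qed

lemma funpow_add_apply: "(f ^^ m) ((f ^^ n) z) = (f ^^ (m + n)) z"
  by (simp add: funpow_add)

lemma compact_cl_U: "compact {z. norm ((f ^^ n) z) \<le> R}"
proof -
  have "closed {z. norm ((f ^^ n) z) \<le> R}"
    by (intro closed_Collect_le continuous_intros cont_iter)
  then show ?thesis
    using cl_U_subset[of n] bounded_subset[OF bounded_cball] compact_eq_bounded_closed by blast
qed

lemma K_eq: "K = (\<Inter>n. {z. norm ((f ^^ n) z) \<le> R})"
proof
  show "K \<subseteq> (\<Inter>n. {z. norm ((f ^^ n) z) \<le> R})" unfolding K_def U_def using less_imp_le by blast
  have "(\<Inter>n. {z. norm ((f ^^ n) z) \<le> R}) \<subseteq> U m" for m
    using cl_U_Suc_subset[of m] by blast
  then show "(\<Inter>n. {z. norm ((f ^^ n) z) \<le> R}) \<subseteq> K" unfolding K_def by blast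
qed

lemma compact_K: "compact K"
  unfolding K_eq using compact_cl_U by (intro compact_Inter) auto

lemma zero_in_K: "0 \<in> K"
proof -
  have "(f ^^ n) 0 = 0" for n by (induction n) (auto simp: fix0)
  then show ?thesis by (simp add: K_def U_def R_pos)
qed

lemma iter_in_K: "z \<in> K \<Longrightarrow> (f ^^ n) z \<in> K"
  by (auto simp: K_def U_def funpow_add_apply)

lemma cl_U_subset_nbhd:
  assumes "open S" "K \<subseteq> S"
  shows "\<exists>n. {z. norm ((f ^^ n) z) \<le> R} \<subseteq> S"
proof (rule ccontr)
  assume c: "\<not> ?thesis"
  let ?C = "\<lambda>n. {z. norm ((f ^^ n) z) \<le> R} - S"
  have "\<Inter>(range ?C) \<noteq> {}"
  proof (rule compact_nest)
    show "compact (?C n)" for n using compact_cl_U assms(1) by (rule compact_diff)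
    show "?C n \<noteq> {}" for n using c by blast
    have "{z. norm ((f ^^ Suc n) z) \<le> R} \<subseteq> {z. norm ((f ^^ n) z) \<le> R}" for n
      using cl_U_Suc_subset[of n] by (auto simp: U_def)
    then have "{z. norm ((f ^^ n) z) \<le> R} \<subseteq> {z. norm ((f ^^ m) z) \<le> R}" if "m \<le> n" for m n
      using that by (rule lift_Suc_antimono_le[of "\<lambda>n. {z. norm ((f ^^ n) z) \<le> R}"])
    then show "?C n \<subseteq> ?C m" if "m \<le> n" for m n using that by blast
  qed
  then show False using assms(2) K_eq by auto
qed

section \<open>Inverse branches of the iterates\<close>

lemma ex_U_disjoint_V: "\<exists>N. U N \<inter> V = {}"
proof -
  obtain n where n: "\<And>v. v \<in> V \<Longrightarrow> R \<le> norm ((f ^^ n v) v)" using V_escape by metis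
  obtain N where N: "\<And>v. v \<in> V \<Longrightarrow> n v \<le> N" using finV
    by (metis finite_nat_set_iff_bounded_le finite_imageI imageI)
  have "v \<notin> U N" if "v \<in> V" for v
    using U_mono[OF N[OF that]] n[OF that] by (auto simp: U_def)
  then show ?thesis by blast
qed

text \<open>A level by which every point of \<open>V\<close> has escaped; the components of
  \<open>U N\<close> serve as domains for the inverse branches of all iterates.\<close>

definition N where "N = (SOME N. U N \<inter> V = {})"

lemma U_N_disjoint: "U N \<inter> V = {}"
  unfolding N_def using ex_U_disjoint_V by (rule someI_ex)

lemma components_U:
  assumes "W \<in> components (U n)"
  shows "open W" "connected W" "W \<noteq> {}" "W \<subseteq> U n" "simply_connected W"
    "(f ^^ n) ` W = ball 0 R"
proof -
  show "open W" using assms open_U open_components by blast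
  show "connected W" "W \<noteq> {}" "W \<subseteq> U n"
    using assms in_components_connected in_components_nonempty in_components_subset by blast+
  show "simply_connected W"
    using assms simply_connected_component_norm_less[OF holo_iter] unfolding U_def by blast
  have "bounded (U n)" using U_subset_ball bounded_ball bounded_subset by blast
  then show "(f ^^ n) ` W = ball 0 R"
    using assms component_norm_less_image[OF holo_iter] unfolding U_def by blast
qed

definition branches :: "nat \<Rightarrow> complex set \<Rightarrow> (complex \<Rightarrow> complex) set" where
  "branches m W = {h. h holomorphic_on W \<and> (\<forall>w\<in>W. (f ^^ m) (h w) = w)}"

text \<open>Induction with \<open>W\<close> varying: an inverse branch \<open>g\<close> of
  \<open>f\<close> sends \<open>W\<close> into \<open>U (Suc N)\<close>, hence by connectedness into
  a single component \<open>W'\<close> of \<open>U N\<close>. That component again avoids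
  \<open>V\<close>, so the induction hypothesis applies to it.\<close>

lemma ex_branch:
  assumes "W \<in> components (U N)" "(f ^^ m) z \<in> W"
  shows "\<exists>h\<in>branches m W. h ((f ^^ m) z) = z"
  using assms
proof (induction m arbitrary: W)
  case 0
  have "(\<lambda>z. z) \<in> branches 0 W" by (simp add: branches_def)
  then show ?case by force
next
  case (Suc m)
  note W = components_U[OF Suc.prems(1)]
  let ?y = "(f ^^ m) z"
  have "W \<inter> V = {}" using W(4) U_N_disjoint by blast
  then obtain g where g: "g holomorphic_on W" "\<And>w. w \<in> W \<Longrightarrow> f (g w) = w" "g (f ?y) = ?y"
    using branch[OF W(1) W(5), of ?y] Suc.prems(2) by auto
  have gU: "g ` W \<subseteq> U N"
  proof -
    have "g w \<in> U (Suc N)" if "w \<in> W" for w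
      using g(2)[OF that] W(4) that by (auto simp: U_def funpow_swap1)
    then show ?thesis using U_mono[of N "Suc N"] by auto
  qed
  have yg: "?y \<in> g ` W" using g(3) Suc.prems(2) by (metis funpow.simps(2) image_eqI o_apply)
  define W' where "W' = connected_component_set (U N) ?y"
  have W': "W' \<in> components (U N)" unfolding W'_def using yg gU by (auto intro: componentsI)
  have "connected (g ` W)"
    using W(2) g(1) holomorphic_on_imp_continuous_on connected_continuous_image by blast
  then have gW': "g ` W \<subseteq> W'"
    unfolding W'_def using yg gU by (simp add: connected_component_maximal)
  obtain h where h: "h \<in> branches m W'" "h ?y = z"
    using Suc.IH[OF W'] yg gW' by blast
  have "h \<circ> g \<in> branches (Suc m) W"
    using h(1) g gW' unfolding branches_def
    by (auto intro!: holomorphic_on_compose intro: holomorphic_on_subset)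
  moreover have "(h \<circ> g) ((f ^^ Suc m) z) = z" using g(3) h(2) by simp
  ultimately show ?case by blast
qed

section \<open>Normality and shrinking of the branches\<close>

lemma branch_image_subset_ball:
  assumes "W \<in> components (U N)" "h \<in> branches m W"
  shows "h ` W \<subseteq> ball 0 R"
proof -
  have "h w \<in> U (N + m)" if "w \<in> W" for w
    using assms that components_U(4)[OF assms(1)]
    by (auto simp: branches_def U_def simp flip: funpow_add_apply)
  then show ?thesis using U_subset_ball by blast
qed

text \<open>If branches of ever higher iterates had a nonconstant limit \<open>g\<close>, then by Hurwitz every value
  of \<open>g\<close> would be a value of infinitely many branches, so the open set \<open>g ` W\<close> would consist of
  non-escaping points.\<close>

lemma branch_limit_constant:
  assumes W: "W \<in> components (U N)"
    and m: "\<And>k. k \<le> m k" and h: "\<And>k. h k \<in> branches (m k) W"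
    and g: "g holomorphic_on W"
    and lim: "\<And>L. \<lbrakk>compact L; L \<subseteq> W\<rbrakk> \<Longrightarrow> uniform_limit L h g sequentially"
  shows "g constant_on W"
proof (rule ccontr)
  assume nc: "\<not> g constant_on W"
  note WW = components_U[OF W]
  have pt: "(\<lambda>k. h k w) \<longlonglongrightarrow> g w" if "w \<in> W" for w
    using lim[of "{w}"] that by (auto intro: tendsto_uniform_limitI)
  have gK: "g z0 \<in> K" if z0: "z0 \<in> W" for z0
  proof (rule ccontr)
    assume "g z0 \<notin> K"
    then obtain n where n: "g z0 \<notin> U n" by (auto simp: K_def)
    \<comment> \<open>The shift by \<open>n\<close> ensures \<open>n \<le> m (k + n)\<close> for
      every \<open>k\<close>. A zero of \<open>?h k\<close> would then put \<open>g z0\<close> into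
      \<open>U n\<close>, so no member of the sequence vanishes, and Hurwitz contradicts the zero of
      the limit at \<open>z0\<close>.\<close>
    let ?h = "\<lambda>k z. h (k + n) z - g z0"
    have "g z0 - g z0 \<noteq> 0"
    proof (rule Hurwitz_no_zeros[of W ?h "\<lambda>z. g z - g z0"])
      show "open W" "connected W" "z0 \<in> W" using WW z0 by auto
      show "?h k holomorphic_on W" for k
        using h by (auto simp: branches_def intro!: holomorphic_intros)
      show "(\<lambda>z. g z - g z0) holomorphic_on W" using g by (auto intro!: holomorphic_intros)
      show "\<not> (\<lambda>z. g z - g z0) constant_on W"
        using nc unfolding constant_on_def by (metis diff_eq_eq)
      show "uniform_limit L ?h (\<lambda>z. g z - g z0) sequentially" if L: "compact L" "L \<subseteq> W" for L
      proof -
        have "uniform_limit L (\<lambda>k. h (k + n)) g sequentially"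
          unfolding uniform_limit_iff
        proof (intro allI impI)
          fix d :: real assume "0 < d"
          then have "eventually (\<lambda>k. \<forall>z\<in>L. dist (h k z) (g z) < d) sequentially"
            using lim[OF L] unfolding uniform_limit_iff by blast
          then show "eventually (\<lambda>k. \<forall>z\<in>L. dist (h (k + n) z) (g z) < d) sequentially"
            by (rule sequentially_offset)
        qed
        then show ?thesis by (intro uniform_limit_intros)
      qed
      show "?h k z \<noteq> 0" if "z \<in> W" for k z
      proof
        assume "?h k z = 0"
        then have "(f ^^ m (k + n)) (g z0) = z" using h[of "k + n"] that by (auto simp: branches_def)
        then have "(f ^^ m (k + n)) (g z0) \<in> ball 0 R"
          using that WW(4) U_subset_ball by blast
        then have "g z0 \<in> U (m (k + n))" by (simp add: U_def)
        moreover have "n \<le> m (k + n)" using m[of "k + n"] by simp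
        ultimately show False using n U_mono by blast
      qed
    qed
    then show False by simp
  qed
  \<comment> \<open>Otherwise \<open>W \<subseteq> K\<close>, and since \<open>f ^^ N\<close> maps
    \<open>W\<close> onto the ball, the ball would equal the compact set \<open>K\<close>.\<close>
  obtain z where z: "z \<in> W" "z \<notin> K"
  proof -
    have "\<not> W \<subseteq> K"
    proof
      assume "W \<subseteq> K"
      then have "(f ^^ N) ` W \<subseteq> K" using iter_in_K by (meson image_subsetI subsetD)
      then have "ball 0 R \<subseteq> K" using WW(6) by simp
      moreover have "K \<subseteq> ball 0 R" unfolding K_def using U_subset_ball[of 0] by blast
      ultimately have "ball 0 R = K" by (rule equalityI)
      then have "compact (ball (0::complex) R)" using compact_K by simp
      then have "closed (ball (0::complex) R)" by (rule compact_imp_closed)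
      moreover have "ball (0::complex) R \<noteq> {}" using R_pos by simp
      moreover have "ball (0::complex) R \<noteq> UNIV"
        using bounded_ball not_bounded_UNIV by metis
      ultimately show False using clopen open_ball by blast
    qed
    then show ?thesis using that by blast
  qed
  \<comment> \<open>\<open>h k z\<close> tends to \<open>g z\<close> and so enters this open subset
    of \<open>K\<close>; but \<open>f ^^ m k\<close> carries it back to \<open>z\<close>, which is
    not in \<open>K\<close>.\<close>
  have "open (g ` W)" using open_mapping_thm[OF g WW(1,2) WW(1) order_refl nc] .
  then have "eventually (\<lambda>k. h k z \<in> g ` W) sequentially"
    using pt[OF z(1)] z(1) topological_tendstoD by blast
  then obtain k where "h k z \<in> g ` W" by (meson eventually_sequentially order_refl)
  then have "h k z \<in> K" using gK by auto
  then have "(f ^^ m k) (h k z) \<in> K" by (rule iter_in_K)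
  then show False using h[of k] z by (simp add: branches_def)
qed

text \<open>Branches violating the bound for ever larger \<open>m\<close> would, by Montel, have a
  subsequence converging uniformly on \<open>L\<close>. Its limit is constant, so the images of
  \<open>L\<close> along it have diameter tending to 0.\<close>

lemma branches_shrink:
  assumes W: "W \<in> components (U N)" and L: "compact L" "L \<subseteq> W" and e: "0 < e"
  shows "\<exists>M. \<forall>m\<ge>M. \<forall>h\<in>branches m W. \<forall>x\<in>L. \<forall>y\<in>L. dist (h x) (h y) < e"
proof (rule ccontr)
  assume "\<not> ?thesis"
  then have "\<forall>k. \<exists>m h x y. k \<le> m \<and> h \<in> branches m W \<and> x \<in> L \<and> y \<in> L \<and> e \<le> dist (h x) (h y)"
    by (meson not_less)
  then obtain m h x y where m: "\<And>k. k \<le> m k" and h: "\<And>k. h k \<in> branches (m k) W"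
    and xy: "\<And>k. x k \<in> L" "\<And>k. y k \<in> L" "\<And>k. e \<le> dist (h k (x k)) (h k (y k))"
    by metis
  let ?H = "{h. h holomorphic_on W \<and> h ` W \<subseteq> ball 0 R}"
  have rng: "range h \<subseteq> ?H"
    using h branch_image_subset_ball[OF W h] unfolding branches_def by blast
  obtain g r where g: "g holomorphic_on W" and r: "strict_mono (r :: nat \<Rightarrow> nat)"
    and lim: "\<And>C. \<lbrakk>compact C; C \<subseteq> W\<rbrakk> \<Longrightarrow> uniform_limit C (h \<circ> r) g sequentially"
  proof (rule Montel[OF components_U(1)[OF W], of ?H h])
    show "h' holomorphic_on W" if "h' \<in> ?H" for h' using that by blast
    show "\<exists>B. \<forall>h\<in>?H. \<forall>z\<in>C. norm (h z) \<le> B" if "C \<subseteq> W" for C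
      using that by (intro exI[of _ R]) force
  qed (use rng in simp, rule that)
  have "g constant_on W"
  proof (rule branch_limit_constant[OF W _ _ g lim])
    show "k \<le> (m \<circ> r) k" for k using m[of "r k"] seq_suble[OF r, of k] by simp
    show "(h \<circ> r) k \<in> branches ((m \<circ> r) k) W" for k using h by simp
  qed
  then obtain c where c: "\<And>z. z \<in> W \<Longrightarrow> g z = c" by (auto simp: constant_on_def)
  have "eventually (\<lambda>k. \<forall>z\<in>L. dist ((h \<circ> r) k z) (g z) < e/2) sequentially"
    using lim[OF L] e unfolding uniform_limit_iff by (meson half_gt_zero)
  then obtain k where "\<forall>z\<in>L. dist (h (r k) z) (g z) < e/2"
    by (auto simp: eventually_sequentially)
  then have "dist (h (r k) (x (r k))) c < e/2" "dist (h (r k) (y (r k))) c < e/2"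
    using xy(1,2) L(2) c by (metis subsetD)+
  then have "dist (h (r k) (x (r k))) (h (r k) (y (r k))) < e"
    by (metis dist_commute dist_triangle_half_r)
  then show False using xy(3)[of "r k"] by simp
qed

text \<open>The components are disjoint and open, so compact \<open>L\<close> meets only finitely
  many of them, each in a compact set; the maximum of the finitely many thresholds works.\<close>

lemma branches_shrink_uniform:
  assumes L: "compact L" "L \<subseteq> U N" and e: "0 < e"
  shows "\<exists>M. \<forall>m\<ge>M. \<forall>W\<in>components (U N). \<forall>h\<in>branches m W.
           \<forall>x\<in>L\<inter>W. \<forall>y\<in>L\<inter>W. dist (h x) (h y) < e"
proof -
  have "L \<subseteq> \<Union>(components (U N))" using L by simp
  then obtain D where D: "D \<subseteq> components (U N)" "finite D" "L \<subseteq> \<Union>D"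
    using compactE[OF L(1)] components_U(1) by metis
  have "\<exists>M. \<forall>m\<ge>M. \<forall>h\<in>branches m W. \<forall>x\<in>L\<inter>W. \<forall>y\<in>L\<inter>W. dist (h x) (h y) < e" if "W \<in> D" for W
  proof (rule branches_shrink)
    show W: "W \<in> components (U N)" using that D by blast
    have "L \<inter> W = L - \<Union>(components (U N) - {W})"
      using L(2) W Union_components[of "U N"] components_nonoverlap[of W "U N"] by blast
    moreover have "open (\<Union>(components (U N) - {W}))" using components_U(1) by blast
    ultimately show "compact (L \<inter> W)" using L(1) compact_diff by metis
  qed (use e in auto)
  then obtain M where M: "\<And>W m h x y. \<lbrakk>W \<in> D; M W \<le> m; h \<in> branches m W; x \<in> L \<inter> W; y \<in> L \<inter> W\<rbrakk>
      \<Longrightarrow> dist (h x) (h y) < e"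
    by metis
  obtain M' where M': "\<And>W. W \<in> D \<Longrightarrow> M W \<le> M'"
    using D(2) by (metis finite_nat_set_iff_bounded_le finite_imageI imageI)
  have "dist (h x) (h y) < e"
    if *: "M' \<le> m" "W \<in> components (U N)" "h \<in> branches m W" "x \<in> L \<inter> W" "y \<in> L \<inter> W"
    for m W h x y
  proof -
    obtain W' where "W' \<in> D" "x \<in> W'" using D(3) *(4) by blast
    then have "W \<in> D" using components_nonoverlap[of W "U N" W'] * D(1) by blast
    then show ?thesis using M M' * by (meson order_trans)
  qed
  then show ?thesis by blast
qed

section \<open>Total disconnectedness of \<open>K\<close> and convergence of preimages\<close>

lemma K_subset_U: "K \<subseteq> U n" by (auto simp: K_def)

lemma connected_subset_branch_image:
  assumes W: "W \<in> components (U N)" and C: "connected C" "(f ^^ m) ` C \<subseteq> W"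
    and h: "h \<in> branches m W" and z: "z \<in> C" "h ((f ^^ m) z) = z"
  shows "\<forall>x\<in>C. h ((f ^^ m) x) = x"
proof -
  note WW = components_U[OF W]
  have hol: "h holomorphic_on W" and inv: "\<And>w. w \<in> W \<Longrightarrow> (f ^^ m) (h w) = w"
    using h by (auto simp: branches_def)
  let ?S = "{x \<in> C. h ((f ^^ m) x) = x}"
  have conth: "continuous_on W h" using hol by (rule holomorphic_on_imp_continuous_on)
  have cont: "continuous_on C (\<lambda>x. h ((f ^^ m) x) - x)"
    using continuous_on_compose2[OF conth cont_iter C(2)] by (intro continuous_intros)
  have "closedin (top_of_set C) ?S"
    using continuous_closedin_preimage[OF cont, of "{0}"] by (simp add: vimage_def Int_def)
  moreover have "?S = C \<inter> h ` W"
  proof (intro equalityI subsetI)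
    fix x assume "x \<in> C \<inter> h ` W"
    then obtain w where "x \<in> C" "w \<in> W" "x = h w" by blast
    then show "x \<in> ?S" using inv by simp
  qed (use C(2) in force)
  moreover have "open (h ` W)"
    using open_mapping_thm3[OF hol WW(1)] inv by (metis inj_onI)
  ultimately have "?S = {} \<or> ?S = C"
    using C(1) unfolding connected_clopen by (metis openin_open_Int)
  then show ?thesis using z by blast
qed

lemma connected_subset_K_trivial:
  assumes C: "connected C" "C \<subseteq> K" and xy: "x \<in> C" "y \<in> C"
  shows "x = y"
proof (rule ccontr)
  assume "x \<noteq> y"
  then have "0 < dist x y" by simp
  then obtain m where m: "\<And>W h u v. \<lbrakk>W \<in> components (U N); h \<in> branches m W; u \<in> K \<inter> W; v \<in> K \<inter> W\<rbrakk>
      \<Longrightarrow> dist (h u) (h v) < dist x y"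
    using branches_shrink_uniform[OF compact_K K_subset_U] by (metis order_refl)
  define W where "W = connected_component_set (U N) ((f ^^ m) x)"
  have fC: "(f ^^ m) ` C \<subseteq> K" using C(2) iter_in_K by blast
  have "connected ((f ^^ m) ` C)" using C(1) cont_iter connected_continuous_image by blast
  then have sub: "(f ^^ m) ` C \<subseteq> W"
    unfolding W_def using fC K_subset_U xy(1) by (intro connected_component_maximal) auto
  have "(f ^^ m) x \<in> U N" using fC K_subset_U xy(1) by blast
  then have W: "W \<in> components (U N)" unfolding W_def by (rule componentsI)
  obtain h where h: "h \<in> branches m W" "h ((f ^^ m) x) = x"
    using ex_branch[OF W] sub xy(1) by blast
  have "h ((f ^^ m) y) = y"
    using connected_subset_branch_image[OF W C(1) sub h(1) xy(1) h(2)] xy(2) by blast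
  then show False
    using m[OF W h(1), of "(f ^^ m) x" "(f ^^ m) y"] h(2) sub fC xy by auto
qed

lemma preimage_near_K:
  assumes e: "0 < e" and w0: "norm w0 < R"
  shows "eventually (\<lambda>m. \<forall>z\<in>{z. (f ^^ m) z = w0}. infdist z K < e) sequentially"
proof -
  let ?S = "{z. infdist z K < e}"
  have "open ?S" by (intro open_Collect_less continuous_intros)
  moreover have "K \<subseteq> ?S" using e by auto
  ultimately obtain n where n: "{z. norm ((f ^^ n) z) \<le> R} \<subseteq> ?S" using cl_U_subset_nbhd by blast
  have "infdist z K < e" if "n \<le> m" "(f ^^ m) z = w0" for m z
  proof -
    have "z \<in> U m" using that w0 by (simp add: U_def)
    then have "z \<in> U n" using U_mono[OF that(1)] by blast
    then have "norm ((f ^^ n) z) \<le> R" by (simp add: U_def)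
    then show ?thesis using n by blast
  qed
  then show ?thesis unfolding eventually_sequentially by blast
qed

text \<open>A branch \<open>h\<close> of \<open>f ^^ k\<close> returns to \<open>z\<close>. Its
  domain maps onto the ball under \<open>f ^^ N\<close>, so it contains some \<open>y\<close> with
  \<open>(f ^^ N) y = w0\<close>; then \<open>h y\<close> is a preimage under
  \<open>f ^^ (N + k)\<close>, close to \<open>z\<close> by shrinking. The points \<open>y\<close>
  are joined to \<open>K\<close> to form the compact set on which shrinking is applied.\<close>

lemma K_near_preimage:
  assumes e: "0 < e" and w0: "norm w0 < R"
  shows "eventually (\<lambda>m. \<forall>z\<in>K. \<exists>x. (f ^^ m) x = w0 \<and> dist z x < e) sequentially"
proof -
  let ?X = "{z. (f ^^ N) z = w0}"
  have "closed ?X" by (intro closed_Collect_eq continuous_intros cont_iter)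
  moreover have XU: "?X \<subseteq> U N" using w0 by (auto simp: U_def)
  moreover have "bounded ?X" using XU U_subset_ball bounded_ball bounded_subset by metis
  ultimately have "compact (K \<union> ?X)"
    using compact_K by (intro compact_Un) (auto simp: compact_eq_bounded_closed)
  moreover have "K \<union> ?X \<subseteq> U N" using XU K_subset_U by blast
  ultimately obtain M where M: "\<And>m W h u v. \<lbrakk>M \<le> m; W \<in> components (U N); h \<in> branches m W;
      u \<in> (K \<union> ?X) \<inter> W; v \<in> (K \<union> ?X) \<inter> W\<rbrakk> \<Longrightarrow> dist (h u) (h v) < e"
    using branches_shrink_uniform[OF _ _ e] by metis
  have "\<exists>x. (f ^^ m) x = w0 \<and> dist z x < e" if m: "M + N \<le> m" and z: "z \<in> K" for m z
  proof -
    define k where "k = m - N"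
    have k: "M \<le> k" "m = N + k" using m by (auto simp: k_def)
    define W where "W = connected_component_set (U N) ((f ^^ k) z)"
    have fz: "(f ^^ k) z \<in> K" using z by (rule iter_in_K)
    then have fzU: "(f ^^ k) z \<in> U N" using K_subset_U by blast
    then have W: "W \<in> components (U N)" unfolding W_def by (rule componentsI)
    have fzW: "(f ^^ k) z \<in> W" unfolding W_def using fzU by simp
    obtain h where h: "h \<in> branches k W" "h ((f ^^ k) z) = z" using ex_branch[OF W fzW] by blast
    obtain y where y: "y \<in> W" "(f ^^ N) y = w0"
      using components_U(6)[OF W] w0 by (metis imageE mem_ball_0)
    have "(f ^^ m) (h y) = w0"
      using h(1) y by (simp add: k(2) branches_def flip: funpow_add_apply)
    moreover have "dist (h ((f ^^ k) z)) (h y) < e"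
      using M[OF k(1) W h(1)] fz fzW y by blast
    ultimately show ?thesis using h(2) by auto
  qed
  then show ?thesis by (auto simp: eventually_sequentially)
qed

lemma hausdorff_limit_preimage:
  assumes w0: "norm w0 < R"
  shows "hausdorff_limit (\<lambda>m. {z. (f ^^ m) z = w0}) K"
    and "hausdorff_limit (\<lambda>m. {z. (f ^^ m) z = w0}) A \<Longrightarrow> A = K"
proof -
  let ?X = "\<lambda>m. {z. (f ^^ m) z = w0}"
  have ne: "?X m \<noteq> {}" for m
  proof -
    have "0 \<in> U m" using zero_in_K K_subset_U by blast
    then have "connected_component_set (U m) 0 \<in> components (U m)" by (rule componentsI)
    then have "w0 \<in> (f ^^ m) ` connected_component_set (U m) 0"
      using components_U(6) w0 by simp
    then show ?thesis by blast
  qed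
  have bd: "bounded (?X m)" for m
  proof -
    have "?X m \<subseteq> U m" using w0 by (auto simp: U_def)
    then show ?thesis using U_subset_ball bounded_ball bounded_subset by metis
  qed
  show lim: "hausdorff_limit ?X K"
  proof (rule hausdorff_limitI[OF _ compact_K ne bd])
    show "K \<noteq> {}" using zero_in_K by blast
    show "eventually (\<lambda>m. \<forall>x\<in>?X m. infdist x K < e) sequentially" if "0 < e" for e
      using preimage_near_K[OF that w0] .
    show "eventually (\<lambda>m. \<forall>a\<in>K. \<exists>x\<in>?X m. dist a x < e) sequentially" if "0 < e" for e
      using K_near_preimage[OF that w0] by simp
  qed
  show "A = K" if "hausdorff_limit ?X A"
    using hausdorff_limit_subset[OF that lim ne bd] hausdorff_limit_subset[OF lim that ne bd] by blast
qed

lemma totally_disconnected_K: "totally_disconnected K"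
  unfolding totally_disconnected_def
proof
  fix C assume C: "C \<in> components K"
  then obtain x where "x \<in> C" using in_components_nonempty by blast
  moreover have "y = x" if "y \<in> C" for y
    using connected_subset_K_trivial in_components_connected[OF C] in_components_subset[OF C]
      that \<open>x \<in> C\<close> by blast
  ultimately show "\<exists>x. C = {x}" by blast
qed

end

section \<open>Cubic polynomials\<close>

text \<open>In \<open>u\<^sup>3 + p u + q\<close> with \<open>q = - s (s\<^sup>2 + p - 1)\<close>, which fixes \<open>s\<close>, the
  critical values are \<open>q \<plusminus> \<i> t\<close> with \<open>t\<^sup>2 = 4 p\<^sup>3 / 27\<close>.  Below, \<open>y = s\<^sup>2\<close>, \<open>X = q\<^sup>2\<close> and \<open>T = t\<^sup>2\<close>; then
  \<open>X + T\<close> is the squared modulus of a critical value, the two-term sum in the second lemma is that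
  of its image, and beyond the squared radius \<open>p + 2\<close> all orbits escape.\<close>

lemma two_step_escape_ge_5:
  fixes p y X T :: real
  assumes p: "0 < p" and y: "0 \<le> y" and X: "X = y * (y + p - 1)^2" and T: "T = 4 * p^3 / 27"
    and a: "5 \<le> p + 3 * y" and small: "X + T \<le> p + 2"
  shows "p + 2 \<le> X * (X + p + 1 - 3 * T)^2"
proof -
  have X0: "0 \<le> X" unfolding X using y by simp
  have p5: "p < 5"
  proof (rule ccontr)
    assume "\<not> p < 5"
    then have "25 * p \<le> p^3" using mult_right_mono[of "5*5" "p*p" p] mult_mono[of 5 p 5 p]
      by (simp add: power3_eq_cube)
    then show False using small X0 T p \<open>\<not> p < 5\<close> by linarith
  qed
  \<comment> \<open>From \<open>a\<close>: \<open>y \<ge> (5 - p) / 3\<close>, hence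
    \<open>y + p - 1 \<ge> (2 + 2 * p) / 3\<close>.\<close>
  have "(5 - p) / 3 * ((2 + 2 * p) / 3)^2 \<le> y * (y + p - 1)^2"
    using a p p5 by (intro mult_mono power_mono) auto
  moreover have "(5 - p) / 3 * ((2 + 2 * p) / 3)^2 = 4 * (5 - p) * (1 + p)^2 / 27"
    by (simp add: power2_eq_square field_simps)
  ultimately have Xlow: "4 * (5 - p) * (1 + p)^2 / 27 \<le> X" unfolding X by simp
  have "4 * (5 - p) * (1 + p)^2 / 27 + 4 * p^3 / 27 \<le> p + 2" using Xlow small T by linarith
  \<comment> \<open>The cubic terms cancel; 136/100 lies just above the positive root of the
    remaining quadratic.\<close>
  then have quad: "12 * p^2 + 9 * p \<le> 34"
    by (simp add: power2_eq_square power3_eq_cube field_simps)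
  have p136: "p \<le> 136/100"
  proof (rule ccontr)
    assume c: "\<not> ?thesis"
    then have "(136/100)^2 \<le> p^2" by (intro power_mono) auto
    then show False using quad c by (simp add: power2_eq_square)
  qed
  have "5 * (1 + p) \<le> (5 - p) * (1 + p) * (1 + p)"
  proof -
    have "p * p \<le> 4 * p" using p p136 by simp
    then have "5 \<le> (5 - p) * (1 + p)" by (simp add: algebra_simps)
    then show ?thesis using p by (intro mult_right_mono) simp_all
  qed
  then have X1: "20 / 27 * (1 + p) \<le> X" using Xlow by (simp add: power2_eq_square algebra_simps)
  have "p^2 \<le> (136/100)^2" using p p136 by (intro power_mono) auto
  then have "p^2 * p \<le> 185/100 * p" using p by (intro mult_right_mono) (auto simp: power2_eq_square)
  then have "p^3 \<le> 185/100 * p" by (simp add: power3_eq_cube power2_eq_square)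
  \<comment> \<open>The bounds on \<open>X\<close> and \<open>T\<close> give at least 47/27 plus a
    positive multiple of \<open>p\<close>, and 174/100 is just below 47/27.\<close>
  then have "174/100 \<le> X + p + 1 - 3 * T" using X1 T p by simp
  then have "(174/100)^2 \<le> (X + p + 1 - 3 * T)^2" by (intro power_mono) auto
  then have "20/27 * (1 + p) * (174/100)^2 \<le> X * (X + p + 1 - 3 * T)^2"
    using X1 X0 p by (intro mult_mono) auto
  then show ?thesis using p by (simp add: power2_eq_square)
qed

text \<open>Here \<open>y\<close> is determined by \<open>p\<close>. The first summand, the squared
  real part of the image, is large enough for \<open>p \<le> 11/10\<close>; the second, the squared
  imaginary part, for larger \<open>p\<close> up to 262/100, a bound that \<open>small\<close>
  provides.\<close>

lemma two_step_escape_eq_4: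
  fixes p y X T :: real
  assumes p: "1 \<le> p" and y: "0 \<le> y" and X: "X = y * (y + p - 1)^2" and T: "T = 4 * p^3 / 27"
    and a: "p + 3 * y = 4" and small: "X + T \<le> p + 2"
  shows "p + 2 \<le> X * (X + p + 1 - 3 * T)^2 + T * (3 * X + p - T)^2"
proof -
  have X0: "0 \<le> X" unfolding X using y by simp
  have T0: "0 \<le> T" unfolding T using p by simp
  have yp: "y = (4 - p) / 3" using a by simp
  have Xp: "X = (4 - p) * (1 + 2 * p)^2 / 27"
    unfolding X yp by (simp add: power2_eq_square field_simps)
  have "12 * p^2 - 12 * p \<le> 50"
    using small unfolding Xp T by (simp add: power2_eq_square power3_eq_cube field_simps)
  have p261: "p \<le> 262/100"
  proof (rule ccontr)
    assume "\<not> ?thesis"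
    then have "262/100 * (162/100) \<le> p * (p - 1)" by (intro mult_mono) auto
    then show False using \<open>12 * p^2 - 12 * p \<le> 50\<close> by (simp add: power2_eq_square algebra_simps)
  qed
  show ?thesis
  proof (cases "p \<le> 11/10")
    case True
    have "29/10 * 3^2 \<le> (4 - p) * (1 + 2 * p)^2" using True p by (intro mult_mono power_mono) auto
    then have X1: "96/100 \<le> X" unfolding Xp by simp
    have "p^3 \<le> (11/10)^3" using True p by (intro power_mono) auto
    then have "2 \<le> X + p + 1 - 3 * T" using X1 T p by (simp add: power3_eq_cube)
    then have "2^2 \<le> (X + p + 1 - 3 * T)^2" by (intro power_mono) auto
    then have "96/100 * 2^2 \<le> X * (X + p + 1 - 3 * T)^2" using X1 by (intro mult_mono) auto
    moreover have "0 \<le> T * (3 * X + p - T)^2" using T0 by simp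
    ultimately show ?thesis using True by simp
  next
    case False
    have B: "3 * X + p - T = (12 + 72 * p + 36 * p^2 - 16 * p^3) / 27"
      unfolding Xp T by (simp add: power2_eq_square power3_eq_cube field_simps)
    \<comment> \<open>On this interval \<open>p^2\<close> lies below its chord, which reduces the
      cubic estimate to a linear one; 113 is chosen so that the latter holds from
      \<open>p = 11/10\<close> on.\<close>
    have "0 \<le> (p - 11/10) * (262/100 - p)" using False p261 by simp
    then have q: "p^2 \<le> 372/100 * p - 2882/1000" by (simp add: power2_eq_square field_simps)
    have "p^2 * (16 * p - 36) \<le> 72 * p + 12 - 113"
    proof -
      have "p^3 \<le> p * (372/100 * p - 2882/1000)"
        using mult_left_mono[OF q, of p] p by (simp add: power3_eq_cube power2_eq_square)
      then have "16 * p^3 - 36 * p^2 \<le> (16 * 372/100 - 36) * p^2 - 16 * 2882/1000 * p"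
        by (simp add: power2_eq_square algebra_simps)
      also have "\<dots> \<le> (16 * 372/100 - 36) * (372/100 * p - 2882/1000) - 16 * 2882/1000 * p"
        using mult_left_mono[OF q, of "16 * 372/100 - 36"] by simp
      also have "\<dots> \<le> 72 * p + 12 - 113" using False by (simp add: field_simps)
      finally show ?thesis by (simp add: power2_eq_square power3_eq_cube algebra_simps)
    qed
    then have "113/27 \<le> 3 * X + p - T" unfolding B by (simp add: power2_eq_square power3_eq_cube algebra_simps)
    then have "(113/27)^2 \<le> (3 * X + p - T)^2" by (intro power_mono) auto
    then have "T * (113/27)^2 \<le> T * (3 * X + p - T)^2" using T0 by (rule mult_left_mono)
    moreover have "p + 2 \<le> T * (113/27)^2"
    proof -
      have "(11/10)^2 \<le> p^2" using False by (intro power_mono) auto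
      then have "121/100 * p \<le> p^3" using mult_right_mono[of "(11/10)^2" "p^2" p] p
        by (simp add: power2_eq_square power3_eq_cube)
      then show ?thesis unfolding T using False by (simp add: power2_eq_square)
    qed
    moreover have "0 \<le> X * (X + p + 1 - 3 * T)^2" using X0 by simp
    ultimately show ?thesis by linarith
  qed
qed

section \<open>Escape of the critical values\<close>

lemma funpow_norm_unbounded:
  fixes P :: "'a::real_normed_vector \<Rightarrow> 'a"
  assumes \<kappa>: "1 < \<kappa>" and \<rho>: "0 < \<rho>" and grow: "\<And>u. \<rho> \<le> norm u \<Longrightarrow> \<kappa> * norm u \<le> norm (P u)"
    and u: "\<rho> \<le> norm u"
  shows "\<exists>n. B \<le> norm ((P ^^ n) u)"
proof -
  have *: "\<rho> * \<kappa> ^ n \<le> norm ((P ^^ n) u)" for n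
  proof (induction n)
    case (Suc n)
    have "\<rho> * 1 \<le> \<rho> * \<kappa> ^ n" using \<kappa> \<rho> by (intro mult_left_mono) auto
    then have "\<kappa> * norm ((P ^^ n) u) \<le> norm ((P ^^ Suc n) u)" using Suc grow by simp
    moreover have "\<kappa> * (\<rho> * \<kappa> ^ n) \<le> \<kappa> * norm ((P ^^ n) u)" using Suc \<kappa> by simp
    ultimately show ?case by (simp add: mult_ac)
  qed (use u in simp)
  obtain n where "B / \<rho> < \<kappa> ^ n" using real_arch_pow[OF \<kappa>] by blast
  then have "B \<le> \<rho> * \<kappa> ^ n" using \<rho> by (simp add: field_simps)
  then show ?thesis using * order_trans by blast
qed

text \<open>Beyond radius \<open>\<rho>\<close> the term \<open>u^3\<close> dominates, and each step
  multiplies the norm by at least \<open>\<rho>^2 - p - \<bar>q\<bar> / \<rho> > 1\<close>.\<close>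

lemma depressed_cubic_unbounded:
  fixes p q \<rho> :: real
  defines "P \<equiv> \<lambda>u::complex. u^3 + of_real p * u + of_real q"
  assumes "0 < \<rho>" "0 \<le> p" "1 + p + \<bar>q\<bar> / \<rho> < \<rho>^2" "\<rho> \<le> norm u"
  shows "\<exists>n. B \<le> norm ((P ^^ n) u)"
proof (rule funpow_norm_unbounded)
  let ?\<kappa> = "\<rho>^2 - p - \<bar>q\<bar> / \<rho>"
  show "1 < ?\<kappa>" using assms by simp
  show "?\<kappa> * norm u \<le> norm (P u)" if u: "\<rho> \<le> norm u" for u
  proof -
    have "u^3 = P u - (of_real p * u + of_real q)" by (simp add: P_def)
    then have "norm (u^3) \<le> norm (P u) + norm (of_real p * u + of_real q)"
      by (metis norm_triangle_ineq4)
    then have "norm (u^3) - norm (of_real p * u) - norm (of_real q :: complex) \<le> norm (P u)"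
      using norm_triangle_ineq[of "of_real p * u" "of_real q"] by linarith
    then have "norm u ^ 3 - p * norm u - \<bar>q\<bar> \<le> norm (P u)"
      using assms(3) by (simp add: norm_power norm_mult)
    moreover have "\<rho>^2 * norm u \<le> norm u ^ 2 * norm u"
      using u assms(2) by (intro mult_right_mono power_mono) auto
    moreover have "\<bar>q\<bar> \<le> \<bar>q\<bar> / \<rho> * norm u"
      using mult_left_mono[OF u, of "\<bar>q\<bar> / \<rho>"] assms(2) by simp
    ultimately show ?thesis by (simp add: algebra_simps power2_eq_square power3_eq_cube)
  qed
qed (use assms in auto)

text \<open>The hypothesis on \<open>u\<close> describes the values of \<open>P\<close> at its
  critical points, the two imaginary square roots of \<open>- p / 3\<close>. If
  \<open>norm u ^ 2 > p + 2\<close>, then \<open>norm u\<close> is itself an escape radius because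
  \<open>\<bar>q\<bar> \<le> norm u\<close>. Otherwise \<open>P u\<close> reaches
  \<open>sqrt (p + 2)\<close>, which is an escape radius because \<open>q^2 < p + 2\<close>.\<close>

lemma depressed_cubic_critical_value_unbounded:
  fixes p s :: real and u :: complex
  defines "q \<equiv> - (s^3 + (p - 1) * s)"
  defines "P \<equiv> \<lambda>u::complex. u^3 + of_real p * u + of_real q"
  assumes p: "0 < p" and a: "5 \<le> p + 3 * s^2 \<or> p + 3 * s^2 = 4 \<and> 1 \<le> p"
    and u: "(u - of_real q)^2 = - of_real (4 * p^3 / 27)"
  shows "\<exists>n. B \<le> norm ((P ^^ n) u)"
proof -
  define T where "T = 4 * p^3 / 27"
  define X where "X = q^2"
  define t where "t = Im u"
  have T0: "0 < T" unfolding T_def using p by simp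
  have X: "X = s^2 * (s^2 + p - 1)^2"
    unfolding X_def q_def by (simp add: power2_eq_square power3_eq_cube algebra_simps)
  have 1: "(Re u - q)^2 - t^2 = - T" "(Re u - q) * t = 0"
    using u unfolding complex_eq_iff t_def T_def by (auto simp: power2_eq_square)
  then have "t \<noteq> 0" using T0 by (metis diff_zero neg_less_0_iff_less not_less power_zero_numeral zero_le_power2)
  then have reu: "Re u = q" and tT: "t^2 = T" using 1 by auto
  have ueq: "u = Complex q t" using reu by (simp add: t_def complex_eq_iff)
  have nu: "norm u ^ 2 = X + T" by (simp add: ueq cmod_power2 X_def tT)
  show ?thesis
  proof (cases "p + 2 < X + T")
    case True
    have pos: "0 < norm u" using True nu p by (smt (verit) norm_ge_zero zero_power2)
    have "\<bar>q\<bar> \<le> norm u" using abs_Re_le_cmod[of u] reu by simp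
    then have "\<bar>q\<bar> / norm u \<le> 1" using pos by simp
    then have "1 + p + \<bar>q\<bar> / norm u < norm u ^ 2" using True nu by linarith
    then show ?thesis
      unfolding P_def using pos p by (intro depressed_cubic_unbounded[where \<rho> = "norm u"]) simp_all
  next
    case False
    have sm: "X + T \<le> p + 2" using False by simp
    have PX: "norm (P u) ^ 2 = X * (X + p + 1 - 3 * T)^2 + T * (3 * X + p - T)^2"
    proof -
      have "Re (P u) = q * (q^2 + p + 1 - 3 * t^2)" "Im (P u) = t * (3 * q^2 + p - t^2)"
        unfolding P_def ueq by (simp_all add: power2_eq_square power3_eq_cube algebra_simps)
      then show ?thesis unfolding cmod_power2 tT X_def by (simp add: power_mult_distrib tT)
    qed
    have "p + 2 \<le> norm (P u) ^ 2"
    proof (cases "5 \<le> p + 3 * s^2")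
      case True
      have "p + 2 \<le> X * (X + p + 1 - 3 * T)^2"
        by (rule two_step_escape_ge_5[OF p _ X T_def True sm]) simp
      moreover have "0 \<le> T * (3 * X + p - T)^2" using T0 by simp
      ultimately show ?thesis unfolding PX by linarith
    next
      case False
      then show ?thesis unfolding PX using a by (intro two_step_escape_eq_4[OF _ _ X T_def _ sm]) auto
    qed
    then have "sqrt (p + 2) \<le> norm (P u)" by (simp add: real_le_lsqrt)
    moreover have "\<bar>q\<bar> < sqrt (p + 2)"
      using sm T0 unfolding X_def by (intro real_less_rsqrt) simp
    moreover have "sqrt (p + 2) ^ 2 = p + 2" using p by simp
    moreover have "0 < sqrt (p + 2)" using p by simp
    ultimately have "\<exists>n. B \<le> norm ((P ^^ n) (P u))"
      unfolding P_def using p by (intro depressed_cubic_unbounded[where \<rho> = "sqrt (p + 2)"]) auto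
    then show ?thesis by (metis funpow_Suc_right o_apply)
  qed
qed

text \<open>Cardano's formula: where the discriminant does not vanish, its square root and then the cube
  root are holomorphic, and the choice of the cube root selects the branch.\<close>

lemma depressed_cubic_branch:
  fixes p :: complex
  assumes W: "open W" "simply_connected W" and p: "p \<noteq> 0"
    and d: "d holomorphic_on W" and disc: "\<And>w. w \<in> W \<Longrightarrow> d w ^ 2 + p^3 / 27 \<noteq> 0"
    and w0: "w0 \<in> W" and u0: "u0^3 + p * u0 = 2 * d w0"
  shows "\<exists>h. h holomorphic_on W \<and> (\<forall>w\<in>W. h w ^ 3 + p * h w = 2 * d w) \<and> h w0 = u0"
proof -
  have log: "\<exists>g. g holomorphic_on W \<and> (\<forall>z\<in>W. f z = exp (g z))"
    if "f holomorphic_on W" "\<And>z. z \<in> W \<Longrightarrow> f z \<noteq> 0" for f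
    using simply_connected_eq_holomorphic_log[OF W(1)] W(2) that by blast
  have "(\<lambda>w. d w ^ 2 + p^3 / 27) holomorphic_on W" using d by (intro holomorphic_intros)
  then obtain L where L: "L holomorphic_on W" "\<And>w. w \<in> W \<Longrightarrow> d w ^ 2 + p^3 / 27 = exp (L w)"
    using log disc by blast
  define \<delta> where "\<delta> w = exp (L w / 2)" for w
  have \<delta>h: "\<delta> holomorphic_on W" unfolding \<delta>_def using L(1) by (intro holomorphic_intros) auto
  have \<delta>: "\<delta> w ^ 2 = d w ^ 2 + p^3 / 27" if "w \<in> W" for w
    using L(2)[OF that] by (simp add: \<delta>_def flip: exp_of_nat_mult)
  have prod: "(d w + \<delta> w) * (d w - \<delta> w) = - (p^3 / 27)" if "w \<in> W" for w
    using \<delta>[OF that] by (simp add: power2_eq_square algebra_simps)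
  have nz: "d w + \<delta> w \<noteq> 0" if "w \<in> W" for w
    using prod[OF that] p by auto
  have "(\<lambda>w. d w + \<delta> w) holomorphic_on W" using d \<delta>h by (intro holomorphic_intros)
  then obtain M where M: "M holomorphic_on W" "\<And>w. w \<in> W \<Longrightarrow> d w + \<delta> w = exp (M w)"
    using log nz by blast
  define A where "A w = exp (M w / 3)" for w
  have Ah: "A holomorphic_on W" unfolding A_def using M(1) by (intro holomorphic_intros) auto
  have A: "A w ^ 3 = d w + \<delta> w" if "w \<in> W" for w
    using M(2)[OF that] by (simp add: A_def flip: exp_of_nat_mult)
  have A0: "A w \<noteq> 0" for w by (simp add: A_def)
  \<comment> \<open>Cardano's substitution, which turns the equation into a quadratic in
    \<open>a^3\<close>.\<close>
  have root: "(a - p / (3 * a))^3 + p * (a - p / (3 * a)) = a^3 - p^3 / (27 * a^3)" if "a \<noteq> 0" for a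
    using that by (simp add: field_simps power2_eq_square power3_eq_cube)
  \<comment> \<open>\<open>u0\<close> is the sum of two numbers with product \<open>- p / 3\<close>,
    whose cubes are \<open>d w0 + \<delta> w0\<close> and \<open>d w0 - \<delta> w0\<close>. The
    sign of \<open>\<delta>\<close> is already fixed, so \<open>a\<close> is the one with the plus
    sign.\<close>
  obtain a where a: "a \<noteq> 0" "u0 = a - p / (3 * a)" "a^3 = d w0 + \<delta> w0"
  proof -
    define e where "e = csqrt (u0^2 + 4 * p / 3)"
    have e: "e^2 = u0^2 + 4 * p / 3" by (simp add: e_def)
    define a b where "a = (u0 + e) / 2" and "b = (u0 - e) / 2"
    have ab: "a * b = - (p / 3)" "a + b = u0"
      using e by (simp_all add: a_def b_def power2_eq_square field_simps)
    have n: "a \<noteq> 0" "b \<noteq> 0" using ab(1) p by auto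
    have b: "b = - (p / (3 * a))" and a: "a = - (p / (3 * b))" using ab(1) n by (simp_all add: field_simps)
    have "a - p / (3 * a) = a + b" using b by simp
    then have ua: "u0 = a - p / (3 * a)" using ab(2) by simp
    have "b - p / (3 * b) = a + b" using a by simp
    then have ub: "u0 = b - p / (3 * b)" using ab(2) by simp
    have "2 * d w0 = a^3 - p^3 / (27 * a^3)"
      using root[OF n(1)] u0 ua by simp
    then have "27 * (a^3)^2 - p^3 = 54 * a^3 * d w0"
      using n(1) by (simp add: field_simps power2_eq_square)
    moreover have "27 * (\<delta> w0)^2 = 27 * (d w0)^2 + p^3" using \<delta>[OF w0] by simp
    ultimately have "27 * ((a^3 - d w0 - \<delta> w0) * (a^3 - d w0 + \<delta> w0)) = 0" by algebra
    then have "(a^3 - d w0 - \<delta> w0) * (a^3 - d w0 + \<delta> w0) = 0" by simp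
    then have "a^3 - d w0 - \<delta> w0 = 0 \<or> a^3 - d w0 + \<delta> w0 = 0" by (simp only: mult_eq_0_iff)
    then consider "a^3 = d w0 + \<delta> w0" | "a^3 = d w0 - \<delta> w0" by (auto simp: algebra_simps)
    then show thesis
    proof cases
      case 1 then show thesis using that[OF n(1) ua] by blast
    next
      case 2
      have "a^3 * b^3 = - (p^3 / 27)"
        using arg_cong[OF ab(1), of "\<lambda>x. x^3"] by (simp add: power_mult_distrib power_divide)
      then have "(d w0 - \<delta> w0) * b^3 = (d w0 - \<delta> w0) * (d w0 + \<delta> w0)"
        using prod[OF w0] 2 by (simp add: mult.commute)
      moreover have "d w0 - \<delta> w0 \<noteq> 0" using 2 n(1) by (metis power_not_zero)
      ultimately have "b^3 = d w0 + \<delta> w0" by simp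
      then show thesis using that[OF n(2) ub] by blast
    qed
  qed
  \<comment> \<open>A cube root of unity that rotates the chosen cube root \<open>A\<close> so that
    the branch passes through \<open>u0\<close>.\<close>
  define \<omega> where "\<omega> = a / A w0"
  have \<omega>: "\<omega> \<noteq> 0" "\<omega>^3 = 1"
    using a A[OF w0] A0[of w0] nz[OF w0] by (auto simp: \<omega>_def power_divide)
  define h where "h w = \<omega> * A w - p / (3 * (\<omega> * A w))" for w
  have "h holomorphic_on W"
    unfolding h_def using Ah \<omega>(1) A0 by (intro holomorphic_intros) auto
  moreover have "h w ^ 3 + p * h w = 2 * d w" if w: "w \<in> W" for w
  proof -
    have "h w ^ 3 + p * h w = (\<omega> * A w)^3 - p^3 / (27 * (\<omega> * A w)^3)"
      unfolding h_def using \<omega>(1) A0[of w] by (intro root) simp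
    also have "(\<omega> * A w)^3 = d w + \<delta> w" using \<omega>(2) A[OF w] by (simp add: power_mult_distrib)
    also have "d w + \<delta> w - p^3 / (27 * (d w + \<delta> w)) = 2 * d w"
    proof -
      have "27 * (\<delta> w)^2 = 27 * (d w)^2 + p^3" using \<delta>[OF w] by simp
      then have "p^3 = 27 * (d w + \<delta> w) * (\<delta> w - d w)"
        by algebra
      then show ?thesis using nz[OF w] by (simp del: distrib_left_numeral)
    qed
    finally show ?thesis .
  qed
  moreover have "h w0 = u0" unfolding h_def \<omega>_def using a A0[of w0] by simp
  ultimately show ?thesis by blast
qed

text \<open>The affine map \<open>\<phi>\<close> conjugates the cubic to \<open>P\<close>:
  \<open>r^2 = a3\<close> makes it monic, \<open>s\<close> removes the quadratic term, and
  \<open>q\<close> is forced because \<open>\<phi> 0 = s\<close> is fixed. Then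
  \<open>p = a1 - a2^2 / (3 * a3)\<close>, which is positive exactly by \<open>disc\<close>, and
  \<open>s^2 \<le> 1\<close> gives \<open>p \<ge> 1\<close> when \<open>a1 = 4\<close>. The set
  \<open>V\<close> is the pullback under \<open>\<phi>\<close> of the critical values of
  \<open>P\<close>.\<close>

lemma escaping_map_cubic:
  fixes a1 a2 a3 :: real
  assumes a: "0 \<le> a1" "0 \<le> a2" "1 \<le> a3" and disc: "a2^2 < 3 * a1 * a3"
    and cases: "5 \<le> a1 \<or> a1 = 4 \<and> a2^2 \<le> 9 * a3"
  shows "\<exists>V. escaping_map (\<lambda>z. of_real a1 * z + of_real a2 * z^2 + of_real a3 * z^3) V (a1 + a2 + 2)"
proof -
  define f :: "complex \<Rightarrow> complex"
    where "f z = of_real a1 * z + of_real a2 * z^2 + of_real a3 * z^3" for z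
  define r where "r = sqrt a3"
  define s where "s = a2 / (3 * r)"
  define p where "p = a1 - 3 * s^2"
  define q where "q = - (s^3 + (p - 1) * s)"
  define P :: "complex \<Rightarrow> complex" where "P u = u^3 + of_real p * u + of_real q" for u
  define \<phi> :: "complex \<Rightarrow> complex" where "\<phi> z = of_real r * z + of_real s" for z
  define V where "V = {w. (\<phi> w - of_real q)^2 = - of_real (4 * p^3 / 27)}"
  have r: "0 < r" "r^2 = a3" using a by (auto simp: r_def)
  have s2: "9 * a3 * s^2 = a2^2"
    using r a by (simp add: s_def power_divide power_mult_distrib)
  have "0 < a3 * p"
    using s2 disc by (simp add: p_def algebra_simps)
  then have p: "0 < p" using a by (simp add: zero_less_mult_iff)
  have p_cases: "5 \<le> p + 3 * s^2 \<or> p + 3 * s^2 = 4 \<and> 1 \<le> p"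
  proof (cases "5 \<le> a1")
    case False
    then have "a1 = 4" "9 * a3 * s^2 \<le> 9 * a3 * 1" using cases s2 by auto
    then show ?thesis using a mult_le_cancel_left_pos[of "9 * a3" "s^2" 1] by (simp add: p_def)
  qed (simp add: p_def)
  have conj: "P (\<phi> z) = \<phi> (f z)" for z
  proof -
    have "a1 = p + 3 * s^2" "a2 = 3 * r * s" "a3 = r^2"
      using r by (simp_all add: p_def s_def)
    then have c: "of_real a1 = (of_real p + 3 * of_real s ^ 2 :: complex)"
      "of_real a2 = (3 * of_real r * of_real s :: complex)" "of_real a3 = (of_real r ^ 2 :: complex)"
      by simp_all
    show ?thesis
      unfolding P_def \<phi>_def f_def c q_def
      by (simp add: power2_eq_square power3_eq_cube algebra_simps)
  qed
  have conj_iter: "(P ^^ n) (\<phi> z) = \<phi> ((f ^^ n) z)" for n z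
    by (induction n) (simp_all add: conj)
  have inj: "\<phi> z = \<phi> w \<longleftrightarrow> z = w" for z w using r by (simp add: \<phi>_def)
  have "escaping_map f V (a1 + a2 + 2)"
  proof
    show "f holomorphic_on UNIV" unfolding f_def by (intro holomorphic_intros)
    show "0 < a1 + a2 + 2" using a by simp
    show "f 0 = 0" by (simp add: f_def)
    \<comment> \<open>The quotient of \<open>f z\<close> by \<open>z\<close> has norm at least
      \<open>norm z ^ 2 - a2 * norm z - a1\<close>, and at this radius that is at least
      \<open>(a1 + 2) * norm z - a1 \<ge> 2\<close>.\<close>
    show "2 * norm z \<le> norm (f z)" if z: "a1 + a2 + 2 \<le> norm z" for z
    proof -
      have "of_real a3 * z^2 = (of_real a1 + of_real a2 * z + of_real a3 * z^2) - (of_real a1 + of_real a2 * z)"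
        by simp
      then have "norm (of_real a3 * z^2) \<le>
          norm (of_real a1 + of_real a2 * z + of_real a3 * z^2) + norm (of_real a1 + of_real a2 * z)"
        by (metis norm_triangle_ineq4)
      moreover have "norm (of_real a1 + of_real a2 * z) \<le> a1 + a2 * norm z"
        using norm_triangle_ineq[of "of_real a1" "of_real a2 * z"] a by (simp add: norm_mult)
      moreover have "norm z * norm z \<le> norm (of_real a3 * z^2)"
        using a mult_right_mono[of 1 a3 "norm z * norm z"]
        by (simp add: norm_mult norm_power power2_eq_square)
      moreover have "(a1 + a2 + 2) * norm z \<le> norm z * norm z" using z by (rule mult_right_mono) simp
      moreover have "a1 + 2 \<le> (a1 + 2) * norm z"
        using a z mult_left_mono[of 1 "norm z" "a1 + 2"] by simp
      ultimately have "2 \<le> norm (of_real a1 + of_real a2 * z + of_real a3 * z^2)"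
        by (simp add: algebra_simps)
      then have "2 * norm z \<le> norm (of_real a1 + of_real a2 * z + of_real a3 * z^2) * norm z"
        by (rule mult_right_mono) simp
      also have "\<dots> = norm (f z)"
        unfolding f_def by (simp add: power2_eq_square power3_eq_cube algebra_simps flip: norm_mult)
      finally show ?thesis .
    qed
    show "finite V"
    proof -
      define e where "e = csqrt (- of_real (4 * p^3 / 27))"
      have "w \<in> {(e + of_real q - of_real s) / of_real r, (- e + of_real q - of_real s) / of_real r}"
        if "w \<in> V" for w
      proof -
        have "(\<phi> w - of_real q)^2 = e^2" using that unfolding V_def e_def by simp
        then have "\<phi> w - of_real q = e \<or> \<phi> w - of_real q = - e" by (simp add: power2_eq_iff)
        then show ?thesis using r by (auto simp: \<phi>_def field_simps)
      qed
      then show ?thesis by (meson finite.emptyI finite.insertI finite_subset subsetI)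
    qed
    show "\<exists>n. a1 + a2 + 2 \<le> norm ((f ^^ n) v)" if v: "v \<in> V" for v
    proof -
      have "(\<phi> v - of_real q)^2 = - of_real (4 * p^3 / 27)" using v by (simp add: V_def)
      \<comment> \<open>The threshold allows for the scaling by \<open>r\<close> and the shift by
        \<open>s\<close> when passing back through \<open>\<phi>\<close>.\<close>
      then obtain n where "r * (a1 + a2 + 2) + \<bar>s\<bar> \<le> norm (((\<lambda>u. u^3 + of_real p * u + of_real q) ^^ n) (\<phi> v))"
        unfolding q_def using depressed_cubic_critical_value_unbounded[OF p p_cases] by blast
      then have "r * (a1 + a2 + 2) + \<bar>s\<bar> \<le> norm (\<phi> ((f ^^ n) v))"
        using conj_iter[of n v] unfolding P_def[abs_def] by simp
      also have "\<dots> \<le> r * norm ((f ^^ n) v) + \<bar>s\<bar>"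
        unfolding \<phi>_def using norm_triangle_ineq[of "of_real r * (f ^^ n) v" "of_real s"] r
        by (simp add: norm_mult)
      finally show ?thesis using r by auto
    qed
    show "\<exists>h. h holomorphic_on W \<and> (\<forall>w\<in>W. f (h w) = w) \<and> h (f z) = z"
      if W: "open W" "simply_connected W" "W \<inter> V = {}" "f z \<in> W" for W z
    proof -
      define d where "d w = (\<phi> w - of_real q) / 2" for w
      have d2: "2 * d w = \<phi> w - of_real q" for w by (simp add: d_def)
      have "\<exists>h. h holomorphic_on W \<and> (\<forall>w\<in>W. h w ^ 3 + of_real p * h w = 2 * d w) \<and> h (f z) = \<phi> z"
      proof (rule depressed_cubic_branch[OF W(1,2) _ _ _ W(4)])
        show "of_real p \<noteq> (0 :: complex)" using p by simp
        show "d holomorphic_on W" unfolding d_def \<phi>_def by (intro holomorphic_intros) auto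
        show "d w ^ 2 + of_real p ^ 3 / 27 \<noteq> 0" if "w \<in> W" for w
        proof
          assume "d w ^ 2 + of_real p ^ 3 / 27 = 0"
          then have "(\<phi> w - of_real q)^2 + 4 * of_real p ^ 3 / 27 = 0"
            by (simp add: d_def power_divide field_simps)
          then have "w \<in> V" by (simp add: V_def eq_neg_iff_add_eq_0)
          then show False using that W(3) by blast
        qed
        show "\<phi> z ^ 3 + of_real p * \<phi> z = 2 * d (f z)"
          unfolding d2 conj[symmetric] by (simp add: P_def)
      qed
      then obtain h where h: "h holomorphic_on W" "\<And>w. w \<in> W \<Longrightarrow> h w ^ 3 + of_real p * h w = 2 * d w"
        "h (f z) = \<phi> z" by blast
      define g where "g w = (h w - of_real s) / of_real r" for w
      have \<phi>g: "\<phi> (g w) = h w" for w using r by (simp add: \<phi>_def g_def)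
      have "g holomorphic_on W" unfolding g_def using h(1) r by (intro holomorphic_intros) auto
      moreover have "f (g w) = w" if "w \<in> W" for w
      proof -
        have "\<phi> (f (g w)) = \<phi> w"
          using h(2)[OF that] unfolding conj[symmetric] \<phi>g d2 by (simp add: P_def)
        then show ?thesis using inj by blast
      qed
      moreover have "g (f z) = z" using \<phi>g[of "f z"] h(3) inj by simp
      ultimately show ?thesis by blast
    qed
  qed
  then show ?thesis unfolding f_def by blast
qed


theorem theorem1p1:
  fixes G :: "'a pair_pre_digraph" and a1 a2 a3 :: nat
  assumes "pair_graph G"
    and "independence_number G = 3"
    and "independence_poly G = [:1, of_nat a1, of_nat a2, of_nat a3:]"
    and "a2^2 < 3 * a1 * a3"
  shows "totally_disconnected (independence_attractor G)"
proof -
  interpret pair_graph G by fact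
  note bounds = independence_number_3_bounds[OF assms]
  define f :: "complex \<Rightarrow> complex" where
    "f z = of_real (real a1) * z + of_real (real a2) * z^2 + of_real (real a3) * z^3" for z
  have disc: "real a2 ^ 2 < 3 * real a1 * real a3" using assms(4) by (metis of_nat_less_iff of_nat_mult of_nat_numeral of_nat_power)
  have "5 \<le> real a1 \<or> real a1 = 4 \<and> real a2 ^ 2 \<le> 9 * real a3"
    using bounds(2) by (metis of_nat_le_iff of_nat_mult of_nat_numeral of_nat_power)
  then obtain V where "escaping_map f V (real a1 + real a2 + 2)"
    using escaping_map_cubic[of "real a1" "real a2" "real a3"] bounds(1) disc unfolding f_def by auto
  then interpret escaping_map f V "real a1 + real a2 + 2" .
  have f: "(\<lambda>z. poly (independence_poly G) z - 1) = f"
    by (simp add: fun_eq_iff assms(3) f_def power2_eq_square power3_eq_cube algebra_simps)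
  have roots: "Roots (independence_poly (lex_power G m)) = {z. (f ^^ m) z = -1}" for m
    using poly_independence_poly_lex_power[OF pair_finite_verts, of m] pair_no_loops
    unfolding Roots_def f by (fastforce simp: eq_neg_iff_add_eq_0)
  \<comment> \<open>The convergence of preimages applies to base points inside the disc of radius
    \<open>R\<close>; here \<open>R \<ge> 2\<close>.\<close>
  have "norm (-1 :: complex) < real a1 + real a2 + 2" by simp
  note limit = hausdorff_limit_preimage[OF this]
  have "independence_attractor G = K"
    unfolding independence_attractor_def roots
    by (rule the_equality) (fact limit(1), erule limit(2))
  then show ?thesis using totally_disconnected_K by simp
qed

end
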